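(* Assume (A1)–(A4) and let $q=\frac{1}{p-1}$. Then there exist constants $C_1,C_2>0$, depending only on $p$ and $\varepsilon_0$, such that for all $(x,t)\in\Omega$: $C_1(\phi+\psi)^p(x,t)\le\partial_t\phi(x,t)\le C_2(\phi+\psi)^p(x,t)$; $C_1(T(x)-t)^{-q-1}\le\partial_t\phi(x,t)\le C_2(T(x)-t)^{-q-1}$; $C_1(\phi+\psi)^p(x,t)\le\partial_t\psi(x,t)\le C_2(\phi+\psi)^p(x,t)$; $C_1(T(x)-t)^{-q-1}\le\partial_t\psi(x,t)\le C_2(T(x)-t)^{-q-1}$; $C_1(T(x)-t)^{-q}\le(\phi+\psi)(x,t)\le C_2(T(x)-t)^{-q}$.
   Context: Let $p>1$ and $\mu>0$ with $p<1+2/\mu$, and let $R^*,T^*>0$. Write $B_R=\{x\in\mathbb{R}:|x|<R\}$ and $D_\pm=\partial_t\pm\partial_x$. Consider the system $D_-\phi=2^{-p}|\phi+\psi|^p-\frac{\mu}{1+t}\frac{\phi+\psi}{2}$, $D_+\psi=2^{-p}|\phi+\psi|^p-\frac{\mu}{1+t}\frac{\phi+\psi}{2}$, $\phi(x,0)=f(x)$, $\psi(x,0)=g(x)$. Fix $\gamma_1,\gamma_2>0$ with $\gamma_1+\gamma_2>\max\big(1,(\mu p 2^p)^{1/(p-1)}\big)$ and let $T_1=\frac{1}{(p-1)\mu}\ln\Big(\frac{2^{1-p}/\mu}{2^{1-p}/\mu-(\gamma_1+\gamma_2)^{1-p}}\Big)$. Assumptions: (A1) $T_1<T^*$. (A2)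 $f\ge\gamma_1$, $g\ge\gamma_2$ on $B_{R^*+T^*}$. (A3) $f,g\in\mathcal{C}^4(\overline{B_{R^*+T^*}})$. (A4) There is $\varepsilon_0>0$ with $2^{-p}(\gamma_1+\gamma_2)^p-\frac{\mu}{2}(\gamma_1+\gamma_2)\ge(2+\varepsilon_0)\max_{x\in B_{R^*+T^*}}(|f'(x)|+|g'(x)|)$. Let $K_{R^*,T^*}=\{(x,t):t>0,\ |x-x_0|<T^*-t\ \text{for some } x_0\in B_{R^*}\}$. Define iterates $\phi_0\equiv\gamma_1$, $\psi_0\equiv\gamma_2$ and, with $\mathcal{N}_n(x,s)=2^{-p}|\phi_n+\psi_n|^p(x,s)-\frac{\mu}{1+s}\frac{(\phi_n+\psi_n)(x,s)}{2}$, $\phi_{n+1}(x,t)=f(x+t)+\int_0^t\mathcal{N}_n(x+t-s,s)\,ds$, $\psi_{n+1}(x,t)=g(x-t)+\int_0^t\mathcal{N}_n(x-t+s,s)\,ds$. Set $\phi=\sup_n\phi_n$, $\psi=\sup_n\psi_n$ on $K_{R^*,T^*}$, $T(x)=\sup\{t\in(0,T^* ):(\phi+\psi)(x,t)<\infty\}$ for $x\in B_{R^*}$, and $\Omega=\{(x,t):x\in B_{R^*},\ 0<t<T(x)\}$; $(\phi,\psi)$ is the solution of the system on $\Omega$. *)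

theory Defs
  imports "HOL-Analysis.Analysis"
begin

definition Ck_on :: "nat \<Rightarrow> real set \<Rightarrow> (real \<Rightarrow> real) \<Rightarrow> bool" where
  "Ck_on k S f \<longleftrightarrow> (\<exists>D :: nat \<Rightarrow> real \<Rightarrow> real. D 0 = f \<and>
      (\<forall>j<k. \<forall>x\<in>S. (D j has_real_derivative D (Suc j) x) (at x within S)) \<and>
      continuous_on S (D k))"

definition nonlin :: "real \<Rightarrow> real \<Rightarrow> real \<Rightarrow> real \<Rightarrow> real" where
  "nonlin p \<mu> u s = 2 powr (-p) * \<bar>u\<bar> powr p - \<mu> / (1 + s) * (u / 2)"

fun iter :: "real \<Rightarrow> real \<Rightarrow> (real \<Rightarrow> real) \<Rightarrow> (real \<Rightarrow> real) \<Rightarrow> real \<Rightarrow> real \<Rightarrow> nat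
      \<Rightarrow> (real \<Rightarrow> real \<Rightarrow> real) \<times> (real \<Rightarrow> real \<Rightarrow> real)" where
  "iter p \<mu> f g \<gamma>1 \<gamma>2 0 = ((\<lambda>x t. \<gamma>1), (\<lambda>x t. \<gamma>2))"
| "iter p \<mu> f g \<gamma>1 \<gamma>2 (Suc n) =
     (let \<Phi> = fst (iter p \<mu> f g \<gamma>1 \<gamma>2 n); \<Psi> = snd (iter p \<mu> f g \<gamma>1 \<gamma>2 n);
          N = (\<lambda>y s. nonlin p \<mu> (\<Phi> y s + \<Psi> y s) s)
      in ((\<lambda>x t. f (x + t) + integral {0..t} (\<lambda>s. N (x + t - s) s)),
          (\<lambda>x t. g (x - t) + integral {0..t} (\<lambda>s. N (x - t + s) s))))"

definition phi_n where "phi_n p \<mu> f g \<gamma>1 \<gamma>2 n = fst (iter p \<mu> f g \<gamma>1 \<gamma>2 n)"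
definition psi_n where "psi_n p \<mu> f g \<gamma>1 \<gamma>2 n = snd (iter p \<mu> f g \<gamma>1 \<gamma>2 n)"

definition phi_sup :: "real \<Rightarrow> real \<Rightarrow> (real \<Rightarrow> real) \<Rightarrow> (real \<Rightarrow> real) \<Rightarrow> real \<Rightarrow> real
     \<Rightarrow> real \<Rightarrow> real \<Rightarrow> ereal" where
  "phi_sup p \<mu> f g \<gamma>1 \<gamma>2 x t = (SUP n. ereal (phi_n p \<mu> f g \<gamma>1 \<gamma>2 n x t))"
definition psi_sup :: "real \<Rightarrow> real \<Rightarrow> (real \<Rightarrow> real) \<Rightarrow> (real \<Rightarrow> real) \<Rightarrow> real \<Rightarrow> real
     \<Rightarrow> real \<Rightarrow> real \<Rightarrow> ereal" where
  "psi_sup p \<mu> f g \<gamma>1 \<gamma>2 x t = (SUP n. ereal (psi_n p \<mu> f g \<gamma>1 \<gamma>2 n x t))"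

text \<open>Real-valued versions (used on Omega, where they are finite).\<close>
definition phi where "phi p \<mu> f g \<gamma>1 \<gamma>2 x t = real_of_ereal (phi_sup p \<mu> f g \<gamma>1 \<gamma>2 x t)"
definition psi where "psi p \<mu> f g \<gamma>1 \<gamma>2 x t = real_of_ereal (psi_sup p \<mu> f g \<gamma>1 \<gamma>2 x t)"

definition blowup_time :: "real \<Rightarrow> real \<Rightarrow> (real \<Rightarrow> real) \<Rightarrow> (real \<Rightarrow> real) \<Rightarrow> real \<Rightarrow> real
     \<Rightarrow> real \<Rightarrow> real \<Rightarrow> real" where
  "blowup_time p \<mu> f g \<gamma>1 \<gamma>2 Tstar x =
     Sup {t. 0 < t \<and> t < Tstar \<and>
          phi_sup p \<mu> f g \<gamma>1 \<gamma>2 x t + psi_sup p \<mu> f g \<gamma>1 \<gamma>2 x t < \<infinity>}"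

definition Omega :: "real \<Rightarrow> real \<Rightarrow> (real \<Rightarrow> real) \<Rightarrow> (real \<Rightarrow> real) \<Rightarrow> real \<Rightarrow> real
     \<Rightarrow> real \<Rightarrow> real \<Rightarrow> (real \<times> real) set" where
  "Omega p \<mu> f g \<gamma>1 \<gamma>2 Rstar Tstar =
     {(x, t). \<bar>x\<bar> < Rstar \<and> 0 < t \<and> t < blowup_time p \<mu> f g \<gamma>1 \<gamma>2 Tstar x}"

definition T1 :: "real \<Rightarrow> real \<Rightarrow> real \<Rightarrow> real" where
  "T1 p \<mu> \<gamma> = 1 / ((p - 1) * \<mu>) *
     ln ((2 powr (1 - p) / \<mu>) / (2 powr (1 - p) / \<mu> - \<gamma> powr (1 - p)))"

end

theory Submission
  imports Defs
begin

text \<open>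
  Write \<open>u = \<phi> + \<psi>\<close>. Assumption (A4) makes every iterate increase along all directions of the
  cone \<open>\<bar>dx\<bar> \<le> (1 + \<epsilon>0) dt\<close>, which is strictly wider than the light cone: the first jump of the time
  derivative, \<open>N \<gamma> 0\<close>, dominates \<open>(2 + \<epsilon>0)\<close> times the slope of the data, and the nonlinearity is increasing in
  \<open>u\<close> and in time. Along its characteristic each component has derivative exactly \<open>N u t\<close>, so comparison
  with the vertical direction gives
  \<open>N u t / 2 \<le> \<partial>\<^sub>t \<phi> \<le> (1 + \<epsilon>0) / \<epsilon>0 * N u t\<close>, and \<open>N u t\<close> is comparable to \<open>u powr p\<close> since the
  damping is absorbed for \<open>u \<ge> \<gamma>1 + \<gamma>2\<close>. Integrating \<open>\<partial>\<^sub>t u \<ge> c * u powr p\<close> up to \<open>T(x)\<close> bounds \<open>u\<close> from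
  above. Conversely, a bound \<open>u(x,t) \<le> M\<close> propagates to the wide cone below \<open>(x,t)\<close>, which contains the light cone
  below \<open>(x,t+h)\<close> up to a time strip of width \<open>O(h)\<close>; hence \<open>u\<close> stays finite up to
  \<open>h = c * M powr (1 - p)\<close>, which bounds \<open>u\<close> from below. Finally \<open>T(x) < T*\<close> because \<open>u\<close> dominates
  the solution of a Bernoulli equation blowing up at \<open>T1\<close>.
\<close>

section \<open>Real analysis preliminaries\<close>

text \<open>Formally, cone monotonicity says
  \<open>(1 + \<epsilon>0) * |\<phi>_x| \<le> \<phi>_t\<close>, while the equation reads
  \<open>\<phi>_t = \<phi>_x + N\<close>; eliminating the space derivative bounds
  \<open>\<phi>_t\<close> on both sides. The upper factor
  \<open>(1 + \<epsilon>0) / \<epsilon>0\<close> shows that a cone of slope exactly one would give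
  no upper bound: this is the purpose of the excess \<open>\<epsilon>0\<close> in (A4). The solution
  is given only as a supremum of iterates, with no regularity known beforehand. Hence each
  inequality is proved for the iterates with constants independent of the index, and differentiating
  the supremum takes uniform convergence of the differentiated iterates. Iterate
  \<open>n + 1\<close> is driven by the nonlinearity at iterate \<open>n\<close>, a mismatch that
  disappears in the limit. The wide cone may leave the domain of dependence, on which alone the data
  are given. The data are therefore extended to the whole line in a way that keeps the bounds of
  (A2) and (A4).\<close>

lemma continuous_on_halfplane_compose:
  fixes H :: "real \<Rightarrow> real \<Rightarrow> real"
  assumes "continuous_on (UNIV \<times> {0..}) (\<lambda>(y, s). H y s)"
    and "continuous_on S a" and "continuous_on S b" and "\<And>z. z \<in> S \<Longrightarrow> 0 \<le> b z"
  shows "continuous_on S (\<lambda>z. H (a z) (b z))"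
proof -
  have "continuous_on S (\<lambda>z. (case (a z, b z) of (y, s) \<Rightarrow> H y s))"
    by (rule continuous_on_compose2[OF assms(1)]) (auto intro!: continuous_intros assms)
  then show ?thesis by simp
qed

lemma integral_rescale_unit:
  fixes h :: "real \<Rightarrow> real"
  assumes "0 \<le> t"
  shows "integral {0..t} h = t * integral {0..1} (\<lambda>r. h (t * r))"
proof (cases "t = 0")
  case True
  then show ?thesis by simp
next
  case False
  with assms have "t > 0" by simp
  then have "(\<lambda>x. x / t) ` {0..t} = {0..1}"
    using image_divide_atLeastAtMost[of t 0 t] by simp
  with integral_stretch_real[of t 0 t h] \<open>t > 0\<close> show ?thesis
    by simp
qed

text \<open>The substitution \<open>s = t * r\<close> moves the variable endpoint into the
  integrand, so that continuity of parameter integrals over a fixed compact interval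
  applies.\<close>

lemma continuous_on_characteristic_integral:
  fixes H :: "real \<Rightarrow> real \<Rightarrow> real"
  assumes "continuous_on (UNIV \<times> {0..}) (\<lambda>(y, s). H y s)"
  shows "continuous_on (UNIV \<times> {0..})
           (\<lambda>(x, t). integral {0..t} (\<lambda>s. H (x + \<sigma> * (t - s)) s))"
proof -
  have "continuous_on ((UNIV \<times> {0..}) \<times> cbox 0 1)
          (\<lambda>z. H (fst (fst z) + \<sigma> * (snd (fst z) - snd (fst z) * snd z)) (snd (fst z) * snd z))"
    by (rule continuous_on_halfplane_compose[OF assms]) (auto intro!: continuous_intros)
  then have "continuous_on (UNIV \<times> {0..})
          (\<lambda>z. integral (cbox 0 1) (\<lambda>r. H (fst z + \<sigma> * (snd z - snd z * r)) (snd z * r)))"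
    by (intro integral_continuous_on_param) (simp add: split_beta)
  then have "continuous_on (UNIV \<times> {0..})
          (\<lambda>z. snd z * integral {0..1} (\<lambda>r. H (fst z + \<sigma> * (snd z - snd z * r)) (snd z * r)))"
    by (auto intro!: continuous_intros)
  then show ?thesis
  proof (rule continuous_on_eq)
    fix z :: "real \<times> real"
    assume "z \<in> UNIV \<times> {0..}"
    then have "0 \<le> snd z" by auto
    from integral_rescale_unit[OF this, of "\<lambda>s. H (fst z + \<sigma> * (snd z - s)) s"]
    show "snd z * integral {0..1} (\<lambda>r. H (fst z + \<sigma> * (snd z - snd z * r)) (snd z * r))
        = (case z of (x, t) \<Rightarrow> integral {0..t} (\<lambda>s. H (x + \<sigma> * (t - s)) s))"
      by (simp add: split_beta)
  qed
qed

text \<open>Integrating the exponential weight gains the factor \<open>1 / K\<close> that drives the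
  contractions. The subtracted \<open>c / K\<close> is kept because it cancels the bound on the data
  in the a priori estimate for space derivatives.\<close>

lemma integral_le_exp:
  fixes h :: "real \<Rightarrow> real"
  assumes "continuous_on {0..t} h" and "0 \<le> t" and "0 < K" and "0 \<le> c"
    and "\<And>s. s \<in> {0..t} \<Longrightarrow> h s \<le> c * exp (K * s)"
  shows "integral {0..t} h \<le> c / K * exp (K * t) - c / K"
proof -
  have I: "((\<lambda>s. c * exp (K * s)) has_integral (c / K * exp (K * t) - c / K * exp (K * 0))) {0..t}"
    using assms
    by (intro fundamental_theorem_of_calculus)
       (auto intro!: derivative_eq_intros simp: has_real_derivative_iff_has_vector_derivative[symmetric])
  have "integral {0..t} h \<le> integral {0..t} (\<lambda>s. c * exp (K * s))"
    by (intro integral_le integrable_continuous_real continuous_intros assms) auto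
  also have "\<dots> = c / K * exp (K * t) - c / K" using integral_unique[OF I] by simp
  finally show ?thesis .
qed

lemma abs_integral_le_exp:
  fixes h :: "real \<Rightarrow> real"
  assumes "continuous_on {0..t} h" and "0 \<le> t" and "0 < K" and "0 \<le> c"
    and "\<And>s. s \<in> {0..t} \<Longrightarrow> \<bar>h s\<bar> \<le> c * exp (K * s)"
  shows "\<bar>integral {0..t} h\<bar> \<le> c / K * exp (K * t) - c / K"
proof -
  have "integral {0..t} h \<le> c / K * exp (K * t) - c / K"
    by (rule integral_le_exp) (use assms abs_le_D1 in auto)
  moreover have "integral {0..t} (\<lambda>s. - h s) \<le> c / K * exp (K * t) - c / K"
    by (rule integral_le_exp) (use assms abs_le_D2 in \<open>auto intro!: continuous_intros\<close>)
  ultimately show ?thesis by simp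
qed

lemma powr_Lipschitz_on_Icc:
  fixes a b r :: real
  assumes "0 < a"
  obtains K where "0 \<le> K" "\<And>u v. u \<in> {a..b} \<Longrightarrow> v \<in> {a..b} \<Longrightarrow> \<bar>u powr r - v powr r\<bar> \<le> K * \<bar>u - v\<bar>"
proof -
  have "continuous_on {a..b} (\<lambda>x. r * x powr (r - 1))"
    using assms by (auto intro!: continuous_intros)
  then have "bounded ((\<lambda>x. r * x powr (r - 1)) ` {a..b})"
    by (intro compact_imp_bounded compact_continuous_image) auto
  then obtain K where "K > 0" and K: "\<And>x. x \<in> {a..b} \<Longrightarrow> \<bar>r * x powr (r - 1)\<bar> \<le> K"
    by (auto simp: bounded_pos)
  have Lip: "\<bar>u powr r - v powr r\<bar> \<le> K * \<bar>u - v\<bar>" if "u \<in> {a..b}" "v \<in> {a..b}" for u v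
  proof -
    have "norm (u powr r - v powr r) \<le> K * norm (u - v)"
    proof (rule field_differentiable_bound)
      show "((\<lambda>x. x powr r) has_real_derivative r * z powr (r - 1)) (at z within {a..b})"
        if "z \<in> {a..b}" for z
        using that assms by (auto intro!: derivative_eq_intros)
    qed (use K that in auto)
    then show ?thesis by simp
  qed
  show ?thesis
    by (rule that[of K]) (use \<open>K > 0\<close> Lip in auto)
qed

lemma halfplane_continuousE:
  fixes H :: "real \<Rightarrow> real \<Rightarrow> real"
  assumes "continuous_on (UNIV \<times> {0..}) (\<lambda>(y, s). H y s)" and "0 \<le> t" and "0 < e"
  obtains d where "0 < d"
    "\<And>y s. 0 \<le> s \<Longrightarrow> \<bar>y - x\<bar> < d \<Longrightarrow> \<bar>s - t\<bar> < d \<Longrightarrow> \<bar>H y s - H x t\<bar> < e"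
proof -
  have "(x, t) \<in> UNIV \<times> {0..}" using assms(2) by simp
  then obtain d where "0 < d" and d: "\<And>z. z \<in> UNIV \<times> {0..} \<Longrightarrow> dist z (x, t) < d \<Longrightarrow>
      dist (case z of (y, s) \<Rightarrow> H y s) (H x t) < e"
    using assms(1,3) unfolding continuous_on_iff by fastforce
  have "\<bar>H y s - H x t\<bar> < e" if "0 \<le> s" "\<bar>y - x\<bar> < d / 2" "\<bar>s - t\<bar> < d / 2" for y s
  proof -
    have "dist (y, s) (x, t) \<le> \<bar>y - x\<bar> + \<bar>s - t\<bar>"
      unfolding dist_Pair_Pair dist_real_def
      using sqrt_sum_squares_le_sum_abs[of "\<bar>y - x\<bar>" "\<bar>s - t\<bar>"] by simp
    with d[of "(y, s)"] that show ?thesis by (simp add: dist_real_def)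
  qed
  with \<open>0 < d\<close> show ?thesis by (intro that[of "d / 2"]) auto
qed

lemma abs_integral_minus_const_le:
  fixes h :: "real \<Rightarrow> real"
  assumes "a \<le> b" "continuous_on {a..b} h" "\<And>s. s \<in> {a..b} \<Longrightarrow> \<bar>h s - c\<bar> \<le> e"
  shows "\<bar>integral {a..b} h - (b - a) * c\<bar> \<le> e * (b - a)"
proof -
  have "norm (integral {a..b} (\<lambda>s. h s - c)) \<le> e * (b - a)"
    using assms by (intro integral_bound continuous_intros) auto
  moreover have "integral {a..b} (\<lambda>s. h s - c) = integral {a..b} h - (b - a) * c"
    using assms by (subst Henstock_Kurzweil_Integration.integral_diff) (auto intro: integrable_continuous_real)
  ultimately show ?thesis by simp
qed

lemma has_real_derivative_ge:
  fixes f :: "real \<Rightarrow> real"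
  assumes "(f has_real_derivative D) (at t)" and "0 < d"
    and "\<And>h. 0 < h \<Longrightarrow> h < d \<Longrightarrow> c * h \<le> f (t + h) - f t"
  shows "c \<le> D"
proof (rule tendsto_lowerbound)
  show "((\<lambda>h. (f (t + h) - f t) / h) \<longlongrightarrow> D) (at_right 0)"
    using assms(1) unfolding DERIV_def by (rule tendsto_within_subset) auto
  show "\<forall>\<^sub>F h in at_right 0. c \<le> (f (t + h) - f t) / h"
    using eventually_at_right_real[OF \<open>0 < d\<close>]
    by eventually_elim (use assms(3) in \<open>auto simp: pos_le_divide_eq\<close>)
qed simp

text \<open>Backward increments suit the upper bound: only the region below \<open>(x, t)\<close> is
  controlled from above by the value at \<open>(x, t)\<close>.\<close>

lemma has_real_derivative_le:
  fixes f :: "real \<Rightarrow> real"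
  assumes "(f has_real_derivative D) (at t)" and "0 < d"
    and "\<And>h. 0 < h \<Longrightarrow> h < d \<Longrightarrow> f t - f (t - h) \<le> c * h"
  shows "D \<le> c"
proof -
  have "((\<lambda>s. f (t - s)) has_real_derivative - D) (at 0)"
  proof -
    have "((\<lambda>s. t - s) has_real_derivative 0 - 1) (at 0)"
      by (intro DERIV_diff DERIV_const DERIV_ident)
    then show ?thesis
      using DERIV_chain2[of f D "\<lambda>s. t - s" 0 "-1" UNIV] assms(1) by simp
  qed
  then have "- c \<le> - D"
    by (rule has_real_derivative_ge[OF _ \<open>0 < d\<close>]) (use assms(3) in force)
  then show ?thesis by simp
qed

text \<open>The explicit tail is the point: for a family of sequences with a common \<open>C\<close>
  it yields uniform convergence.\<close>

lemma geometric_Cauchy_limit: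
  fixes a :: "nat \<Rightarrow> real"
  assumes "\<And>n. \<bar>a (Suc n) - a n\<bar> \<le> C / 2 ^ n"
  obtains l where "a \<longlonglongrightarrow> l" "\<And>n. \<bar>a n - l\<bar> \<le> 2 * C / 2 ^ n"
proof -
  have "0 \<le> C" using assms[of 0] by simp
  \<comment> \<open>Keeping the subtracted remainder of the geometric series lets the induction on
    \<open>k\<close> close.\<close>
  have *: "\<bar>a (n + k) - a n\<bar> \<le> 2 * C / 2 ^ n - 2 * C / 2 ^ (n + k)" for n k
  proof (induction k)
    case (Suc k)
    have "\<bar>a (n + Suc k) - a n\<bar> \<le> \<bar>a (Suc (n + k)) - a (n + k)\<bar> + \<bar>a (n + k) - a n\<bar>"
      by simp
    also have "\<dots> \<le> C / 2 ^ (n + k) + (2 * C / 2 ^ n - 2 * C / 2 ^ (n + k))"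
      by (intro add_mono assms Suc.IH)
    also have "\<dots> = 2 * C / 2 ^ n - 2 * C / 2 ^ (n + Suc k)"
      by (simp add: field_simps)
    finally show ?case .
  qed simp
  have bd: "\<bar>a m - a n\<bar> \<le> 2 * C / 2 ^ n" if "n \<le> m" for m n
  proof -
    have "0 \<le> 2 * C / 2 ^ m" using \<open>0 \<le> C\<close> by simp
    with *[of n "m - n"] that show ?thesis by simp
  qed
  have lim0: "(\<lambda>n. 2 * C / 2 ^ n) \<longlonglongrightarrow> 0"
    by (rule LIMSEQ_divide_realpow_zero) simp
  have "Cauchy a"
    unfolding Cauchy_altdef dist_real_def
  proof (intro allI impI)
    fix e :: real
    assume "0 < e"
    then obtain n0 where "\<And>n. n0 \<le> n \<Longrightarrow> \<bar>2 * C / 2 ^ n\<bar> < e"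
      using lim0 by (auto simp: LIMSEQ_iff)
    then have "\<bar>a m - a n\<bar> < e" if "n0 \<le> m" "m < n" for m n
      using bd[of m n] that \<open>0 \<le> C\<close> by (force simp: abs_minus_commute)
    then show "\<exists>M. \<forall>m\<ge>M. \<forall>n>m. \<bar>a m - a n\<bar> < e" by auto
  qed
  then obtain l where l: "a \<longlonglongrightarrow> l"
    using Cauchy_convergent convergent_def by blast
  have "\<bar>a n - l\<bar> \<le> 2 * C / 2 ^ n" for n
  proof (rule tendsto_upperbound)
    show "(\<lambda>m. \<bar>a n - a m\<bar>) \<longlonglongrightarrow> \<bar>a n - l\<bar>" by (intro tendsto_intros l)
    show "\<forall>\<^sub>F m in sequentially. \<bar>a n - a m\<bar> \<le> 2 * C / 2 ^ n"
      using eventually_ge_at_top[of n]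
      by eventually_elim (subst abs_minus_commute, rule bd)
  qed simp
  with l show ?thesis by (rule that)
qed

lemma SUP_ereal_less_PInf_iff:
  fixes a :: "nat \<Rightarrow> real"
  shows "(SUP n. ereal (a n)) < \<infinity> \<longleftrightarrow> (\<exists>M. \<forall>n. a n \<le> M)"
proof
  assume "(SUP n. ereal (a n)) < \<infinity>"
  moreover have le: "ereal (a n) \<le> (SUP n. ereal (a n))" for n by (rule SUP_upper) simp
  ultimately obtain r where "(SUP n. ereal (a n)) = ereal r"
    by (cases "SUP n. ereal (a n)") (auto dest: spec[of _ 0])
  with le show "\<exists>M. \<forall>n. a n \<le> M" by (metis ereal_less_eq(3))
next
  assume "\<exists>M. \<forall>n. a n \<le> M"
  then obtain M where "\<And>n. a n \<le> M" by blast
  then have "(SUP n. ereal (a n)) \<le> ereal M" by (intro SUP_least) simp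
  then show "(SUP n. ereal (a n)) < \<infinity>" by (rule le_less_trans) simp
qed

lemma SUP_ereal_eq_limit:
  fixes a :: "nat \<Rightarrow> real"
  assumes "incseq a" "a \<longlonglongrightarrow> l"
  shows "(SUP n. ereal (a n)) = ereal l"
proof (rule LIMSEQ_unique)
  show "(\<lambda>n. ereal (a n)) \<longlonglongrightarrow> (SUP n. ereal (a n))"
    using assms(1) by (intro LIMSEQ_SUP) (auto simp: incseq_def)
  show "(\<lambda>n. ereal (a n)) \<longlonglongrightarrow> ereal l"
    using assms(2) by simp
qed

section \<open>Nonlinearity, iterates and the monotonicity cone\<close>

text \<open>\<open>\<sigma> = 1\<close> stands for \<open>\<phi>\<close> and
  \<open>\<sigma> = -1\<close> for \<open>\<psi>\<close>: component \<open>\<sigma>\<close> is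
  transported along the lines where \<open>x + \<sigma> * t\<close> is constant, so one argument
  serves both. Data on the whole line free the cone arguments from any domain of dependence.\<close>

locale damped_wave =
  fixes p \<mu> \<epsilon> :: real and F F' :: "real \<Rightarrow> real \<Rightarrow> real" and \<Gamma> :: "real \<Rightarrow> real"
  assumes p_gt_1: "1 < p" and \<mu>_pos: "0 < \<mu>" and \<epsilon>_pos: "0 < \<epsilon>"
    and \<Gamma>_pos: "\<And>\<sigma>. \<bar>\<sigma>\<bar> = 1 \<Longrightarrow> 0 < \<Gamma> \<sigma>"
    and \<Gamma>_large: "\<mu> * p * 2 powr p < (\<Gamma> 1 + \<Gamma> (-1)) powr (p - 1)"
    and F_ge: "\<And>\<sigma> x. \<bar>\<sigma>\<bar> = 1 \<Longrightarrow> \<Gamma> \<sigma> \<le> F \<sigma> x"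
    and F_deriv: "\<And>\<sigma> x. \<bar>\<sigma>\<bar> = 1 \<Longrightarrow> (F \<sigma> has_real_derivative F' \<sigma> x) (at x)"
    and F'_cont: "\<And>\<sigma>. \<bar>\<sigma>\<bar> = 1 \<Longrightarrow> continuous_on UNIV (F' \<sigma>)"
    and F'_small: "\<And>\<sigma> x. \<bar>\<sigma>\<bar> = 1 \<Longrightarrow>
       (2 + \<epsilon>) * \<bar>F' \<sigma> x\<bar> \<le> 2 powr (-p) * (\<Gamma> 1 + \<Gamma> (-1)) powr p - \<mu> / 2 * (\<Gamma> 1 + \<Gamma> (-1))"
begin

section \<open>Growth and monotonicity of the damped nonlinearity\<close>

definition \<gamma> :: real where "\<gamma> = \<Gamma> 1 + \<Gamma> (-1)"

abbreviation N :: "real \<Rightarrow> real \<Rightarrow> real" where "N u s \<equiv> nonlin p \<mu> u s"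

definition dN :: "real \<Rightarrow> real \<Rightarrow> real" where
  "dN u s = 2 powr (-p) * (p * u powr (p - 1)) - \<mu> / (1 + s) / 2"

lemma \<gamma>_pos: "0 < \<gamma>"
  using \<Gamma>_pos[of 1] \<Gamma>_pos[of "-1"] by (simp add: \<gamma>_def)

text \<open>The source of constants independent of \<open>\<mu>\<close>: the damping coefficient is
  at most \<open>\<mu> / 2\<close>, so it removes at most half of the power term.\<close>

lemma absorb_damping:
  assumes "\<gamma> \<le> u"
  shows "\<mu> \<le> 2 powr (-p) * u powr (p - 1)"
proof -
  have "\<mu> * 2 powr p \<le> \<mu> * p * 2 powr p"
    using p_gt_1 \<mu>_pos by simp
  also have "\<dots> \<le> \<gamma> powr (p - 1)"
    using \<Gamma>_large by (simp add: \<gamma>_def)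
  also have "\<dots> \<le> u powr (p - 1)"
    using assms \<gamma>_pos p_gt_1 by (intro powr_mono2) auto
  finally show ?thesis
    by (simp add: powr_minus field_simps)
qed

lemma nonlin_factor:
  assumes "0 < u"
  shows "N u s = u * (2 powr (-p) * u powr (p - 1) - \<mu> / (1 + s) / 2)"
  using assms by (simp add: nonlin_def powr_diff field_simps)

lemma damping_le:
  assumes "0 \<le> s" shows "\<mu> / (1 + s) / 2 \<le> \<mu> / 2"
  using assms \<mu>_pos by (simp add: field_simps)

text \<open>Both factors in \<open>nonlin_factor\<close> are nonnegative and increasing, the second
  one also in time because the damping decays. Monotonicity in time is what allows comparison of
  points at different heights of the cone.\<close>

lemma nonlin_mono:
  assumes "\<gamma> \<le> u" "u \<le> v" "0 \<le> s" "s \<le> s'"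
  shows "N u s \<le> N v s'"
proof -
  have pos: "0 < u" "0 < v" using assms \<gamma>_pos by auto
  have "u powr (p - 1) \<le> v powr (p - 1)"
    using assms pos p_gt_1 by (intro powr_mono2) auto
  moreover have "\<mu> / (1 + s') / 2 \<le> \<mu> / (1 + s) / 2"
    using assms \<mu>_pos by (intro divide_right_mono divide_left_mono) auto
  ultimately have *: "2 powr (-p) * u powr (p - 1) - \<mu> / (1 + s) / 2
      \<le> 2 powr (-p) * v powr (p - 1) - \<mu> / (1 + s') / 2"
    by (intro diff_mono mult_left_mono) auto
  have "0 \<le> 2 powr (-p) * u powr (p - 1) - \<mu> / (1 + s) / 2"
    using absorb_damping[OF assms(1)] damping_le[OF assms(3)] \<mu>_pos by linarith
  with * show ?thesis
    using assms pos by (auto simp: nonlin_factor intro!: mult_mono)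
qed

lemma nonlin_lower:
  assumes "\<gamma> \<le> u" "0 \<le> s"
  shows "2 powr (-p) * u powr p / 2 \<le> N u s"
proof -
  have "0 < u" using assms \<gamma>_pos by linarith
  have "2 powr (-p) * u powr (p - 1) / 2 \<le> 2 powr (-p) * u powr (p - 1) - \<mu> / (1 + s) / 2"
    using absorb_damping[OF assms(1)] damping_le[OF assms(2)] by linarith
  then have "u * (2 powr (-p) * u powr (p - 1) / 2) \<le> N u s"
    using \<open>0 < u\<close> by (simp add: nonlin_factor)
  then show ?thesis using \<open>0 < u\<close> by (simp add: powr_diff)
qed

lemma nonlin_upper:
  assumes "\<gamma> \<le> u" "0 \<le> s"
  shows "N u s \<le> 2 powr (-p) * u powr p"
  using assms \<gamma>_pos \<mu>_pos by (simp add: nonlin_def)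

lemma nonlin_nonneg: "\<gamma> \<le> u \<Longrightarrow> 0 \<le> s \<Longrightarrow> 0 \<le> N u s"
  by (rule order_trans[OF _ nonlin_lower]) auto

lemma nonlin_deriv:
  assumes "0 < u"
  shows "((\<lambda>u. N u s) has_real_derivative dN u s) (at u)"
proof -
  have "((\<lambda>u. 2 powr (-p) * u powr p - c * (u / 2)) has_real_derivative
      2 powr (-p) * (p * u powr (p - 1)) - c / 2) (at u)" for c
    using assms by (auto intro!: derivative_eq_intros)
  from this[of "\<mu> / (1 + s)"]
  have "((\<lambda>u. 2 powr (-p) * u powr p - \<mu> / (1 + s) * (u / 2)) has_real_derivative dN u s) (at u)"
    unfolding dN_def .
  then show ?thesis
    by (rule has_field_derivative_transform_within_open[of _ _ _ "{0<..}"])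
       (use assms in \<open>auto simp: nonlin_def\<close>)
qed

text \<open>The constant is uniform in time because \<open>s\<close> enters only through the bounded
  damping coefficient. For \<open>p < 2\<close> the function \<open>dN\<close> is not Lipschitz near
  \<open>u = 0\<close>; the floor \<open>\<gamma> > 0\<close> excludes that region.\<close>

lemma nonlin_Lipschitz:
  obtains K where "0 < K"
    "\<And>u v s. u \<in> {\<gamma>..M} \<Longrightarrow> v \<in> {\<gamma>..M} \<Longrightarrow> 0 \<le> s \<Longrightarrow> \<bar>N u s - N v s\<bar> \<le> K * \<bar>u - v\<bar>"
    "\<And>u v s. u \<in> {\<gamma>..M} \<Longrightarrow> v \<in> {\<gamma>..M} \<Longrightarrow> 0 \<le> s \<Longrightarrow> \<bar>dN u s - dN v s\<bar> \<le> K * \<bar>u - v\<bar>"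
    "\<And>u s. u \<in> {\<gamma>..M} \<Longrightarrow> 0 \<le> s \<Longrightarrow> \<bar>dN u s\<bar> \<le> K"
proof -
  obtain A where A: "0 \<le> A" "\<And>u v. u \<in> {\<gamma>..M} \<Longrightarrow> v \<in> {\<gamma>..M} \<Longrightarrow>
      \<bar>u powr (p - 1) - v powr (p - 1)\<bar> \<le> A * \<bar>u - v\<bar>"
    using powr_Lipschitz_on_Icc[OF \<gamma>_pos, of M "p - 1"] by blast
  define B where "B = 2 powr (-p) * (p * M powr (p - 1)) + \<mu> / 2"
  have "0 < B" unfolding B_def using p_gt_1 \<mu>_pos by (intro add_nonneg_pos) auto
  have dN_bd: "\<bar>dN u s\<bar> \<le> B" if "u \<in> {\<gamma>..M}" "0 \<le> s" for u s
  proof -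
    have "u powr (p - 1) \<le> M powr (p - 1)"
      using that \<gamma>_pos p_gt_1 by (intro powr_mono2) auto
    then have "2 powr (-p) * (p * u powr (p - 1)) \<le> 2 powr (-p) * (p * M powr (p - 1))"
      using p_gt_1 by simp
    moreover have "0 \<le> 2 powr (-p) * (p * u powr (p - 1))" "0 \<le> \<mu> / (1 + s) / 2"
      using p_gt_1 \<mu>_pos that by simp_all
    ultimately show ?thesis
      unfolding dN_def B_def using damping_le[OF that(2)] by linarith
  qed
  have N_Lip: "\<bar>N u s - N v s\<bar> \<le> B * \<bar>u - v\<bar>" if "u \<in> {\<gamma>..M}" "v \<in> {\<gamma>..M}" "0 \<le> s" for u v s
  proof -
    have "norm (N u s - N v s) \<le> B * norm (u - v)"
    proof (rule field_differentiable_bound)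
      show "((\<lambda>u. N u s) has_real_derivative dN z s) (at z within {\<gamma>..M})" if "z \<in> {\<gamma>..M}" for z
        using that \<gamma>_pos by (intro has_field_derivative_at_within[OF nonlin_deriv]) auto
    qed (use that dN_bd in auto)
    then show ?thesis by simp
  qed
  have dN_Lip: "\<bar>dN u s - dN v s\<bar> \<le> 2 powr (-p) * p * A * \<bar>u - v\<bar>"
    if "u \<in> {\<gamma>..M}" "v \<in> {\<gamma>..M}" for u v s
  proof -
    have "\<bar>dN u s - dN v s\<bar> = 2 powr (-p) * p * \<bar>u powr (p - 1) - v powr (p - 1)\<bar>"
      using p_gt_1 by (simp add: dN_def flip: right_diff_distrib add: abs_mult)
    also have "\<dots> \<le> 2 powr (-p) * p * (A * \<bar>u - v\<bar>)"
      using p_gt_1 A(2)[OF that] by (intro mult_left_mono) auto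
    finally show ?thesis by (simp add: mult.assoc)
  qed
  define K where "K = B + 2 powr (-p) * p * A"
  have K: "B \<le> K" "2 powr (-p) * p * A \<le> K" "0 < K"
    using A(1) p_gt_1 \<open>0 < B\<close> unfolding K_def by (auto intro: add_pos_nonneg)
  show ?thesis
  proof (rule that[OF K(3)])
    show "\<bar>N u s - N v s\<bar> \<le> K * \<bar>u - v\<bar>" if "u \<in> {\<gamma>..M}" "v \<in> {\<gamma>..M}" "0 \<le> s" for u v s
      using N_Lip[OF that] K(1) by (meson abs_ge_zero mult_right_mono order_trans)
    show "\<bar>dN u s - dN v s\<bar> \<le> K * \<bar>u - v\<bar>" if "u \<in> {\<gamma>..M}" "v \<in> {\<gamma>..M}" "0 \<le> s" for u v s
      using dN_Lip[OF that(1,2), of s] K(2) by (meson abs_ge_zero mult_right_mono order_trans)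
    show "\<bar>dN u s\<bar> \<le> K" if "u \<in> {\<gamma>..M}" "0 \<le> s" for u s
      using dN_bd[OF that] K(1) by linarith
  qed
qed

section \<open>The two components as one signed family of iterates\<close>

definition W :: "real \<Rightarrow> nat \<Rightarrow> real \<Rightarrow> real \<Rightarrow> real" where
  "W \<sigma> = (if \<sigma> = 1 then phi_n p \<mu> (F 1) (F (-1)) (\<Gamma> 1) (\<Gamma> (-1))
          else psi_n p \<mu> (F 1) (F (-1)) (\<Gamma> 1) (\<Gamma> (-1)))"

definition U :: "nat \<Rightarrow> real \<Rightarrow> real \<Rightarrow> real" where
  "U n x t = W 1 n x t + W (-1) n x t"

lemma W_0: "\<bar>\<sigma>\<bar> = 1 \<Longrightarrow> W \<sigma> 0 x t = \<Gamma> \<sigma>"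
  by (cases "\<sigma> = 1") (auto simp: W_def phi_n_def psi_n_def abs_if split: if_splits)

lemma W_Suc:
  assumes "\<bar>\<sigma>\<bar> = 1"
  shows "W \<sigma> (Suc n) x t
    = F \<sigma> (x + \<sigma> * t) + integral {0..t} (\<lambda>s. N (U n (x + \<sigma> * (t - s)) s) s)"
proof -
  have "\<sigma> = 1 \<or> \<sigma> = -1" using assms by (auto simp: abs_if split: if_splits)
  then show ?thesis
    by (auto simp: U_def W_def phi_n_def psi_n_def Let_def algebra_simps)
qed

lemma continuous_on_nonlin:
  assumes "continuous_on (UNIV \<times> {0..}) (\<lambda>(y, s). u y s)"
  shows "continuous_on (UNIV \<times> {0..}) (\<lambda>(y, s). N (u y s) s)"
proof -
  have u: "continuous_on (UNIV \<times> {0..}) (\<lambda>z. u (fst z) (snd z))"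
    using assms by (simp add: split_beta)
  have "continuous_on (UNIV \<times> {0..}) (\<lambda>z. N (u (fst z) (snd z)) (snd z))"
    unfolding nonlin_def
    using p_gt_1
    by (intro continuous_on_diff continuous_on_mult continuous_on_divide continuous_on_powr' u
        continuous_on_rabs continuous_intros) auto
  then show ?thesis by (simp add: split_beta)
qed

lemma continuous_on_F: "\<bar>\<sigma>\<bar> = 1 \<Longrightarrow> continuous_on S (F \<sigma>)"
  by (meson F_deriv DERIV_continuous continuous_at_imp_continuous_on)

lemma W_continuous:
  "\<bar>\<sigma>\<bar> = 1 \<Longrightarrow> continuous_on (UNIV \<times> {0..}) (\<lambda>(x, t). W \<sigma> n x t)"
proof (induction n arbitrary: \<sigma>)
  case 0
  then show ?case by (simp add: W_0)
next
  case (Suc n)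
  have "continuous_on (UNIV \<times> {0..}) (\<lambda>(x, t). U n x t)"
    unfolding U_def using Suc.IH[of 1] Suc.IH[of "-1"]
    by (auto simp: split_beta intro!: continuous_intros)
  from continuous_on_characteristic_integral[OF continuous_on_nonlin[OF this], of \<sigma>]
  have "continuous_on (UNIV \<times> {0..})
      (\<lambda>z. F \<sigma> (fst z + \<sigma> * snd z)
         + integral {0..snd z} (\<lambda>s. N (U n (fst z + \<sigma> * (snd z - s)) s) s))"
    using Suc.prems
    by (intro continuous_on_add continuous_on_compose2[OF continuous_on_F[of \<sigma> UNIV]] continuous_intros)
       (auto simp: split_beta)
  then show ?case by (simp add: W_Suc[OF Suc.prems] split_beta)
qed

lemma U_continuous: "continuous_on (UNIV \<times> {0..}) (\<lambda>(x, t). U n x t)"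
  unfolding U_def using W_continuous[of 1 n] W_continuous[of "-1" n]
  by (auto simp: split_beta intro!: continuous_intros)

lemma nonlin_char_continuous:
  assumes "S \<subseteq> {0..}"
  shows "continuous_on S (\<lambda>s. N (U n (x + \<sigma> * (t - s)) s) s)"
  by (rule continuous_on_halfplane_compose[OF continuous_on_nonlin[OF U_continuous]])
     (use assms in \<open>auto intro!: continuous_intros\<close>)

lemma nonlin_char_integrable:
  assumes "0 \<le> a"
  shows "(\<lambda>s. N (U n (x + \<sigma> * (t - s)) s) s) integrable_on {a..b}"
  by (rule integrable_continuous_real, rule nonlin_char_continuous) (use assms in auto)

text \<open>Restarting the integral equation at time \<open>r\<close> turns an increment along a
  short piece of a characteristic into an integral over that piece alone.\<close>

lemma W_Suc_from:
  assumes "\<bar>\<sigma>\<bar> = 1" "0 \<le> r" "r \<le> t"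
  shows "W \<sigma> (Suc n) x t = W \<sigma> (Suc n) (x + \<sigma> * (t - r)) r
     + integral {r..t} (\<lambda>s. N (U n (x + \<sigma> * (t - s)) s) s)"
proof -
  have "integral {0..r} (\<lambda>s. N (U n (x + \<sigma> * (t - s)) s) s)
      + integral {r..t} (\<lambda>s. N (U n (x + \<sigma> * (t - s)) s) s)
      = integral {0..t} (\<lambda>s. N (U n (x + \<sigma> * (t - s)) s) s)"
    using assms by (intro Henstock_Kurzweil_Integration.integral_combine nonlin_char_integrable) auto
  then show ?thesis
    using assms(1) by (simp add: W_Suc algebra_simps)
qed

lemma W_ge: "\<bar>\<sigma>\<bar> = 1 \<Longrightarrow> 0 \<le> t \<Longrightarrow> \<Gamma> \<sigma> \<le> W \<sigma> n x t"
proof (induction n arbitrary: \<sigma> x t)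
  case 0
  then show ?case by (simp add: W_0)
next
  case (Suc n)
  have "\<gamma> \<le> U n y s" if "0 \<le> s" for y s
    using Suc.IH[of 1 s y] Suc.IH[of "-1" s y] that by (simp add: U_def \<gamma>_def)
  then have "0 \<le> integral {0..t} (\<lambda>s. N (U n (x + \<sigma> * (t - s)) s) s)"
    by (intro integral_nonneg nonlin_char_integrable nonlin_nonneg) auto
  then show ?case
    using F_ge[OF Suc.prems(1), of "x + \<sigma> * t"] by (simp add: W_Suc[OF Suc.prems(1)])
qed

lemma U_ge: "0 \<le> t \<Longrightarrow> \<gamma> \<le> U n x t"
  using W_ge[of 1 t n x] W_ge[of "-1" t n x] by (simp add: U_def \<gamma>_def)

lemma W_le_Suc: "\<bar>\<sigma>\<bar> = 1 \<Longrightarrow> 0 \<le> t \<Longrightarrow> W \<sigma> n x t \<le> W \<sigma> (Suc n) x t"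
proof (induction n arbitrary: \<sigma> x t)
  case 0
  then show ?case using W_ge[of \<sigma> t "Suc 0" x] by (simp add: W_0)
next
  case (Suc n)
  have "U n y s \<le> U (Suc n) y s" if "0 \<le> s" for y s
    using Suc.IH[of 1 s y] Suc.IH[of "-1" s y] that by (simp add: U_def)
  then have "integral {0..t} (\<lambda>s. N (U n (x + \<sigma> * (t - s)) s) s)
      \<le> integral {0..t} (\<lambda>s. N (U (Suc n) (x + \<sigma> * (t - s)) s) s)"
    by (intro integral_le nonlin_char_integrable nonlin_mono U_ge) auto
  then show ?case
    by (simp only: W_Suc[OF Suc.prems(1)])
qed

lemma W_incseq: "\<bar>\<sigma>\<bar> = 1 \<Longrightarrow> 0 \<le> t \<Longrightarrow> incseq (\<lambda>n. W \<sigma> n x t)"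
  by (simp add: incseq_SucI W_le_Suc)

lemma U_incseq: "0 \<le> t \<Longrightarrow> incseq (\<lambda>n. U n x t)"
  using W_incseq[of 1 t x] W_incseq[of "-1" t x] by (force simp: U_def incseq_def intro: add_mono)

section \<open>Monotonicity along the wide cone\<close>

lemma F_Lipschitz:
  assumes "\<bar>\<sigma>\<bar> = 1"
  shows "(2 + \<epsilon>) * \<bar>F \<sigma> x - F \<sigma> y\<bar> \<le> N \<gamma> 0 * \<bar>x - y\<bar>"
proof -
  have N0: "N \<gamma> 0 = 2 powr (-p) * \<gamma> powr p - \<mu> / 2 * \<gamma>"
    using \<gamma>_pos by (simp add: nonlin_def)
  have "norm (F \<sigma> x - F \<sigma> y) \<le> N \<gamma> 0 / (2 + \<epsilon>) * norm (x - y)"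
  proof (rule field_differentiable_bound[of UNIV])
    show "norm (F' \<sigma> z) \<le> N \<gamma> 0 / (2 + \<epsilon>)" for z
    proof -
      have "(2 + \<epsilon>) * \<bar>F' \<sigma> z\<bar> \<le> N \<gamma> 0"
        unfolding N0 using F'_small[OF assms, of z] by (simp add: \<gamma>_def)
      then show ?thesis
        using \<epsilon>_pos by (simp add: pos_le_divide_eq mult.commute)
    qed
  qed (use F_deriv[OF assms] in auto)
  then show ?thesis using \<epsilon>_pos by (simp add: field_simps)
qed

text \<open>The jump \<open>N \<gamma> 0 * h\<close> gained over the first \<open>h\<close> time units pays for the variation of the data; the rest
  is inherited from the previous iterate through the monotone nonlinearity.\<close>

lemma W_cone_mono:
  "\<bar>\<sigma>\<bar> = 1 \<Longrightarrow> 0 \<le> t \<Longrightarrow> 0 \<le> h \<Longrightarrow> \<bar>a\<bar> \<le> (1 + \<epsilon>) * h \<Longrightarrow> W \<sigma> n x t \<le> W \<sigma> n (x + a) (t + h)"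
proof (induction n arbitrary: \<sigma> x t)
  case 0
  then show ?case by (simp add: W_0)
next
  case (Suc n)
  have U_le: "U n y s \<le> U n (y + a) (s + h)" if "0 \<le> s" for y s
    using Suc.IH[of 1 s y] Suc.IH[of "-1" s y] Suc.prems that by (simp add: U_def)
  have "N \<gamma> 0 * h = integral {0..h} (\<lambda>s. N \<gamma> 0)"
    using Suc.prems by simp
  also have "\<dots> \<le> integral {0..h} (\<lambda>s. N (U n (x + a + \<sigma> * t + \<sigma> * (h - s)) s) s)"
    by (intro integral_le nonlin_char_integrable nonlin_mono U_ge integrable_const_ivl) auto
  finally have jump: "F \<sigma> (x + a + \<sigma> * t + \<sigma> * h) + N \<gamma> 0 * h \<le> W \<sigma> (Suc n) (x + a + \<sigma> * t) h"
    by (simp add: W_Suc[OF Suc.prems(1)])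
  \<comment> \<open>Origin of the factor \<open>2 + \<epsilon>\<close> in (A4): a displacement of
    slope \<open>1 + \<epsilon>\<close> plus the unit speed of the characteristic.\<close>
  have "\<bar>a + \<sigma> * h\<bar> \<le> (2 + \<epsilon>) * h"
    using Suc.prems abs_triangle_ineq[of a "\<sigma> * h"] by (simp add: abs_mult algebra_simps)
  then have "N \<gamma> 0 * \<bar>a + \<sigma> * h\<bar> \<le> N \<gamma> 0 * ((2 + \<epsilon>) * h)"
    by (intro mult_left_mono nonlin_nonneg) auto
  moreover have "\<bar>x + \<sigma> * t - (x + a + \<sigma> * t + \<sigma> * h)\<bar> = \<bar>a + \<sigma> * h\<bar>"
    by linarith
  ultimately have "(2 + \<epsilon>) * \<bar>F \<sigma> (x + \<sigma> * t) - F \<sigma> (x + a + \<sigma> * t + \<sigma> * h)\<bar> \<le> (2 + \<epsilon>) * (N \<gamma> 0 * h)"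
    using F_Lipschitz[OF Suc.prems(1), of "x + \<sigma> * t" "x + a + \<sigma> * t + \<sigma> * h"]
    by (simp add: mult.left_commute)
  then have "F \<sigma> (x + \<sigma> * t) \<le> F \<sigma> (x + a + \<sigma> * t + \<sigma> * h) + N \<gamma> 0 * h"
    using \<epsilon>_pos by (simp add: mult_le_cancel_left)
  with jump have "F \<sigma> (x + \<sigma> * t) \<le> W \<sigma> (Suc n) (x + a + \<sigma> * t) h"
    by linarith
  moreover have "integral {0..t} (\<lambda>s. N (U n (x + \<sigma> * (t - s)) s) s)
      \<le> integral {h..t + h} (\<lambda>s. N (U n (x + a + \<sigma> * (t + h - s)) s) s)"
  proof -
    \<comment> \<open>The endpoints display the shift by \<open>h\<close> explicitly, in the form in
      which the substitution \<open>s + h\<close> is undone afterwards.\<close>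
    have "integral {0..t} (\<lambda>s. N (U n (x + \<sigma> * (t - s)) s) s)
      \<le> integral {h-h..t+h-h} (\<lambda>s. N (U n (x + a + \<sigma> * (t + h - (s + h))) (s + h)) (s + h))"
    proof (simp, intro integral_le nonlin_char_integrable nonlin_mono U_ge)
      show "(\<lambda>s. N (U n (x + a + \<sigma> * (t - s)) (s + h)) (s + h)) integrable_on {0..t}"
        using Suc.prems
        by (intro integrable_continuous_real
             continuous_on_halfplane_compose[OF continuous_on_nonlin[OF U_continuous], where b = "\<lambda>s. s + h"])
           (auto intro!: continuous_intros)
      show "U n (x + \<sigma> * (t - s)) s \<le> U n (x + a + \<sigma> * (t - s)) (s + h)" if "s \<in> {0..t}" for s
        using U_le[of s "x + \<sigma> * (t - s)"] that by (simp add: algebra_simps)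
    qed (use Suc.prems in auto)
    then show ?thesis by (subst (asm) integral_shift_real_ivl)
  qed
  ultimately show ?case
    using W_Suc_from[OF Suc.prems(1), of h "t + h" n "x + a"] Suc.prems by (simp add: W_Suc)
qed

lemma W_cone_mono':
  assumes "\<bar>\<sigma>\<bar> = 1" "0 \<le> s" "s \<le> t" "\<bar>y - x\<bar> \<le> (1 + \<epsilon>) * (t - s)"
  shows "W \<sigma> n y s \<le> W \<sigma> n x t"
  using W_cone_mono[of \<sigma> s "t - s" "x - y" n y] assms by (simp add: abs_minus_commute)

lemma U_cone_mono:
  assumes "0 \<le> s" "s \<le> t" "\<bar>y - x\<bar> \<le> (1 + \<epsilon>) * (t - s)"
  shows "U n y s \<le> U n x t"
  using W_cone_mono'[of 1 s t y x n] W_cone_mono'[of "-1" s t y x n] assms by (simp add: U_def)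

subsection \<open>Derivatives of the iterates\<close>

text \<open>The recursion \<open>W_Suc\<close> differentiated formally in \<open>x\<close>. Defined
  this way, \<open>V\<close> is continuous before it is known to be a derivative, as differentiation
  under the integral requires.\<close>

primrec V :: "nat \<Rightarrow> real \<Rightarrow> real \<Rightarrow> real \<Rightarrow> real" where
  "V 0 \<sigma> x t = 0"
| "V (Suc n) \<sigma> x t = F' \<sigma> (x + \<sigma> * t) + integral {0..t} (\<lambda>s. dN (U n (x + \<sigma> * (t - s)) s) s *
     (V n 1 (x + \<sigma> * (t - s)) s + V n (-1) (x + \<sigma> * (t - s)) s))"

lemma dN_U_continuous: "continuous_on (UNIV \<times> {0..}) (\<lambda>(y, s). dN (U n y s) s)"
proof -
  have u: "continuous_on (UNIV \<times> {0..}) (\<lambda>z. U n (fst z) (snd z))"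
    using U_continuous by (simp add: split_beta)
  have pos: "U n (fst z) (snd z) \<noteq> 0" if "z \<in> UNIV \<times> {0..}" for z
    using that U_ge[of "snd z" n "fst z"] \<gamma>_pos by auto
  have "continuous_on (UNIV \<times> {0..}) (\<lambda>z. U n (fst z) (snd z) powr (p - 1))"
    by (rule continuous_on_powr[OF u continuous_on_const]) (use pos in blast)
  then have "continuous_on (UNIV \<times> {0..}) (\<lambda>z. 2 powr (-p) * (p * U n (fst z) (snd z) powr (p - 1)))"
    by (intro continuous_on_mult_left)
  moreover have "continuous_on (UNIV \<times> {0..}) (\<lambda>z :: real \<times> real. \<mu> / (1 + snd z) / 2)"
    by (intro continuous_intros) auto
  ultimately have "continuous_on (UNIV \<times> {0..}) (\<lambda>z. dN (U n (fst z) (snd z)) (snd z))"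
    unfolding dN_def by (rule continuous_on_diff)
  then show ?thesis by (simp add: split_beta)
qed

lemma V_continuous:
  "\<bar>\<sigma>\<bar> = 1 \<Longrightarrow> continuous_on (UNIV \<times> {0..}) (\<lambda>(x, t). V n \<sigma> x t)"
proof (induction n arbitrary: \<sigma>)
  case 0
  then show ?case by simp
next
  case (Suc n)
  have "continuous_on (UNIV \<times> {0..}) (\<lambda>(y, s). dN (U n y s) s * (V n 1 y s + V n (-1) y s))"
    using Suc.IH[of 1] Suc.IH[of "-1"] dN_U_continuous[of n]
    by (auto simp: split_beta intro!: continuous_intros)
  from continuous_on_characteristic_integral[OF this, of \<sigma>]
  have "continuous_on (UNIV \<times> {0..})
      (\<lambda>z. F' \<sigma> (fst z + \<sigma> * snd z) + integral {0..snd z} (\<lambda>s. dN (U n (fst z + \<sigma> * (snd z - s)) s) s *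
         (V n 1 (fst z + \<sigma> * (snd z - s)) s + V n (-1) (fst z + \<sigma> * (snd z - s)) s)))"
    using Suc.prems
    by (intro continuous_on_add continuous_on_compose2[OF F'_cont] continuous_intros)
       (auto simp: split_beta)
  then show ?case by (simp add: split_beta)
qed

lemma dN_V_continuous:
  "continuous_on (UNIV \<times> {0..}) (\<lambda>(y, s). dN (U n y s) s * (V n 1 y s + V n (-1) y s))"
  using V_continuous[of 1 n] V_continuous[of "-1" n] dN_U_continuous[of n]
  by (auto simp: split_beta intro!: continuous_intros)

lemma W_deriv_x:
  "\<bar>\<sigma>\<bar> = 1 \<Longrightarrow> 0 \<le> t \<Longrightarrow> ((\<lambda>x. W \<sigma> n x t) has_real_derivative V n \<sigma> x t) (at x)"
proof (induction n arbitrary: \<sigma> x t)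
  case 0
  then show ?case by (simp add: W_0)
next
  case (Suc n)
  have dU: "((\<lambda>y. U n y s) has_real_derivative V n 1 y s + V n (-1) y s) (at y)" if "0 \<le> s" for y s
    unfolding U_def by (intro DERIV_add Suc.IH that) auto
  have "((\<lambda>x. integral (cbox 0 t) (\<lambda>s. N (U n (x + \<sigma> * (t - s)) s) s)) has_real_derivative
      integral (cbox 0 t) (\<lambda>s. dN (U n (x + \<sigma> * (t - s)) s) s *
        (V n 1 (x + \<sigma> * (t - s)) s + V n (-1) (x + \<sigma> * (t - s)) s))) (at x within UNIV)"
  proof (rule leibniz_rule_field_derivative)
    show "((\<lambda>x. N (U n (x + \<sigma> * (t - s)) s) s) has_real_derivative
       dN (U n (y + \<sigma> * (t - s)) s) s * (V n 1 (y + \<sigma> * (t - s)) s + V n (-1) (y + \<sigma> * (t - s)) s)) (at y within UNIV)"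
      if "s \<in> cbox 0 t" for y s
    proof (rule DERIV_chain2[OF nonlin_deriv])
      show "0 < U n (y + \<sigma> * (t - s)) s"
        using that U_ge[of s n "y + \<sigma> * (t - s)"] \<gamma>_pos by auto
      show "((\<lambda>x. U n (x + \<sigma> * (t - s)) s) has_real_derivative
          V n 1 (y + \<sigma> * (t - s)) s + V n (-1) (y + \<sigma> * (t - s)) s) (at y)"
        using that dU[of s "y + \<sigma> * (t - s)"] unfolding DERIV_shift by simp
    qed
    have "continuous_on (UNIV \<times> cbox 0 t) (\<lambda>z. dN (U n (fst z + \<sigma> * (t - snd z)) (snd z)) (snd z) *
        (V n 1 (fst z + \<sigma> * (t - snd z)) (snd z) + V n (-1) (fst z + \<sigma> * (t - snd z)) (snd z)))"
      by (rule continuous_on_halfplane_compose[OF dN_V_continuous]) (auto intro!: continuous_intros)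
    then show "continuous_on (UNIV \<times> cbox 0 t) (\<lambda>(y, s). dN (U n (y + \<sigma> * (t - s)) s) s *
        (V n 1 (y + \<sigma> * (t - s)) s + V n (-1) (y + \<sigma> * (t - s)) s))"
      by (simp add: split_beta)
  qed (use nonlin_char_integrable[of 0] in auto)
  moreover have "((\<lambda>x. F \<sigma> (x + \<sigma> * t)) has_real_derivative F' \<sigma> (x + \<sigma> * t)) (at x)"
    using F_deriv[OF Suc.prems(1), of "x + \<sigma> * t"] unfolding DERIV_shift by simp
  ultimately show ?case
    unfolding W_Suc[OF Suc.prems(1)] V.simps by (intro DERIV_add) auto
qed

text \<open>\<open>R\<close> is the increment along the characteristic, an integral of
  \<open>N\<close> over the times between \<open>t\<close> and \<open>t'\<close>, and its derivative
  follows from continuity. The remaining displacement is purely spatial and covered by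
  \<open>W_deriv_x\<close>. The initial iterate is constant and does not satisfy the transport
  equation, hence \<open>Suc n\<close>.\<close>

lemma W_deriv_t:
  assumes "\<bar>\<sigma>\<bar> = 1" "0 < t"
  shows "((\<lambda>t. W \<sigma> (Suc n) x t) has_real_derivative \<sigma> * V (Suc n) \<sigma> x t + N (U n x t) t) (at t)"
proof -
  define R where "R t' = W \<sigma> (Suc n) x t' - W \<sigma> (Suc n) (x + \<sigma> * (t' - t)) t" for t'
  have "(R has_derivative (\<lambda>h. h * N (U n x t) t)) (at t)"
    unfolding has_derivative_at_alt
  proof (intro conjI allI impI)
    show "bounded_linear (\<lambda>h. h * N (U n x t) t)"
      by (rule bounded_linear_mult_left)
    fix e :: real
    assume "0 < e"
    obtain d where "0 < d" and d: "\<And>y s. 0 \<le> s \<Longrightarrow> \<bar>y - x\<bar> < d \<Longrightarrow> \<bar>s - t\<bar> < d \<Longrightarrow>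
        \<bar>N (U n y s) s - N (U n x t) t\<bar> < e"
      using halfplane_continuousE[OF continuous_on_nonlin[OF U_continuous], of t e x] assms(2) \<open>0 < e\<close>
      by (metis less_imp_le)
    have "norm (R t' - R t - (t' - t) * N (U n x t) t) \<le> e * norm (t' - t)" if "\<bar>t' - t\<bar> < min d t" for t'
    proof -
      have pos: "0 < t'" using that by linarith
      have near: "\<bar>N (U n (x + \<sigma> * (t' - s)) s) s - N (U n x t) t\<bar> \<le> e"
        if "\<bar>t' - s\<bar> \<le> \<bar>t' - t\<bar>" "\<bar>s - t\<bar> \<le> \<bar>t' - t\<bar>" "0 \<le> s" for s
        using d[of s "x + \<sigma> * (t' - s)"] that assms(1) \<open>\<bar>t' - t\<bar> < min d t\<close>
        by (simp add: abs_mult)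
      have R0: "R t = 0" by (simp add: R_def)
      show ?thesis
      proof (cases "t \<le> t'")
        case True
        have "\<bar>integral {t..t'} (\<lambda>s. N (U n (x + \<sigma> * (t' - s)) s) s) - (t' - t) * N (U n x t) t\<bar>
            \<le> e * (t' - t)"
          using True assms(2)
          by (intro abs_integral_minus_const_le near nonlin_char_continuous) auto
        then show ?thesis
          using W_Suc_from[OF assms(1), of t t' n x] True assms(2) by (simp add: R0) (simp add: R_def)
      next
        case False
        have "\<bar>integral {t'..t} (\<lambda>s. N (U n (x + \<sigma> * (t' - s)) s) s) - (t - t') * N (U n x t) t\<bar>
            \<le> e * (t - t')"
          using False pos
          by (intro abs_integral_minus_const_le near nonlin_char_continuous) auto
        moreover have "R t' = - integral {t'..t} (\<lambda>s. N (U n (x + \<sigma> * (t' - s)) s) s)"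
          using W_Suc_from[OF assms(1), of t' t n "x + \<sigma> * (t' - t)"] False pos
          by (simp add: R_def algebra_simps)
        ultimately show ?thesis
          using False by (simp add: R0 algebra_simps abs_minus_commute abs_if split: if_splits)
      qed
    qed
    then show "\<exists>d>0. \<forall>t'. norm (t' - t) < d \<longrightarrow>
        norm (R t' - R t - (t' - t) * N (U n x t) t) \<le> e * norm (t' - t)"
      using \<open>0 < d\<close> assms(2) by (intro exI[of _ "min d t"]) auto
  qed
  then have "(R has_real_derivative N (U n x t) t) (at t)"
    unfolding has_field_derivative_def by (metis (no_types, lifting) ext mult.commute)
  moreover have "((\<lambda>t'. W \<sigma> (Suc n) (x + \<sigma> * (t' - t)) t) has_real_derivative V (Suc n) \<sigma> x t * \<sigma>) (at t)"
  proof (rule DERIV_chain2[where f = "\<lambda>y. W \<sigma> (Suc n) y t"])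
    show "((\<lambda>y. W \<sigma> (Suc n) y t) has_real_derivative V (Suc n) \<sigma> x t) (at (x + \<sigma> * (t - t)))"
      using W_deriv_x[OF assms(1), of t "Suc n" x] assms(2) by simp
  qed (auto intro!: derivative_eq_intros)
  ultimately have "((\<lambda>t'. W \<sigma> (Suc n) (x + \<sigma> * (t' - t)) t + R t') has_real_derivative
      V (Suc n) \<sigma> x t * \<sigma> + N (U n x t) t) (at t)"
    by (intro DERIV_add)
  then show ?thesis by (simp add: R_def mult.commute)
qed

text \<open>Comparing the vertical increment with the increment along the characteristic, where the
  derivative is exactly the nonlinearity, through the wide monotonicity cone.\<close>

lemma W_deriv_t_ge:
  assumes "\<bar>\<sigma>\<bar> = 1" "0 < t" and D: "((\<lambda>t. W \<sigma> (Suc n) x t) has_real_derivative D) (at t)"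
  shows "N (U n x t) t / 2 \<le> D"
proof (rule has_real_derivative_ge[OF D zero_less_one])
  fix h :: real
  assume "0 < h"
  \<comment> \<open>Half of the time follows the characteristic away from \<open>x\<close>; the
    other half returns to \<open>x\<close> at unit speed, inside the monotonicity cone. Only the
    first half is credited with growth, hence the factor 1/2.\<close>
  define r where "r = h / 2"
  have "0 < r" using \<open>0 < h\<close> by (simp add: r_def)
  have "r * N (U n x t) t = integral {t..t + r} (\<lambda>s. N (U n x t) t)"
    using \<open>0 < r\<close> by simp
  also have "\<dots> \<le> integral {t..t + r} (\<lambda>s. N (U n (x - \<sigma> * r + \<sigma> * (t + r - s)) s) s)"
  proof (intro integral_le nonlin_char_integrable nonlin_mono U_ge integrable_const_ivl U_cone_mono)
    show "\<bar>x - (x - \<sigma> * r + \<sigma> * (t + r - s))\<bar> \<le> (1 + \<epsilon>) * (s - t)" if "s \<in> {t..t + r}" for s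
    proof -
      have "\<bar>x - (x - \<sigma> * r + \<sigma> * (t + r - s))\<bar> = \<bar>\<sigma> * (s - t)\<bar>" by (simp add: algebra_simps)
      also have "\<dots> \<le> (1 + \<epsilon>) * (s - t)"
        using that assms(1) \<epsilon>_pos by (simp add: abs_mult mult_right_mono[of 1 "1 + \<epsilon>", simplified])
      finally show ?thesis .
    qed
  qed (use assms in auto)
  also have "\<dots> = W \<sigma> (Suc n) (x - \<sigma> * r) (t + r) - W \<sigma> (Suc n) x t"
    using W_Suc_from[OF assms(1), of t "t + r" n "x - \<sigma> * r"] assms(2) \<open>0 < r\<close> by simp
  also have "W \<sigma> (Suc n) (x - \<sigma> * r) (t + r) \<le> W \<sigma> (Suc n) x (t + h)"
    using assms \<open>0 < r\<close> \<epsilon>_pos by (intro W_cone_mono') (auto simp: r_def abs_mult field_simps)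
  finally show "N (U n x t) t / 2 * h \<le> W \<sigma> (Suc n) x (t + h) - W \<sigma> (Suc n) x t"
    by (simp add: r_def mult.commute)
qed

lemma W_deriv_t_le:
  assumes "\<bar>\<sigma>\<bar> = 1" "0 < t" and D: "((\<lambda>t. W \<sigma> (Suc n) x t) has_real_derivative D) (at t)"
  shows "D \<le> (1 + \<epsilon>) / \<epsilon> * N (U n x t) t"
proof -
  \<comment> \<open>\<open>h < d\<close> says exactly that the depth \<open>r\<close> chosen below
    is less than \<open>t\<close>.\<close>
  define d where "d = t * (\<epsilon> / (1 + \<epsilon>))"
  have "0 < d" using assms \<epsilon>_pos by (simp add: d_def)
  show ?thesis
  proof (rule has_real_derivative_le[OF D \<open>0 < d\<close>])
    fix h :: real
    assume "0 < h" "h < d"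
    \<comment> \<open>The solution of \<open>r = (1 + \<epsilon>) * (r - h)\<close>: at depth
      \<open>r\<close> the backward characteristic from \<open>(x, t)\<close> meets the boundary of
      the wide cone below \<open>(x, t - h)\<close>. With slope one they would never meet.\<close>
    define r where "r = (1 + \<epsilon>) / \<epsilon> * h"
    have "0 < r" using \<open>0 < h\<close> \<epsilon>_pos by (simp add: r_def)
    have "r < t" using \<open>h < d\<close> \<epsilon>_pos by (simp add: r_def d_def field_simps)
    have rh: "r = (1 + \<epsilon>) * (r - h)" using \<epsilon>_pos by (simp add: r_def field_simps)
    have "W \<sigma> (Suc n) x t - W \<sigma> (Suc n) (x + \<sigma> * r) (t - r)
        = integral {t - r..t} (\<lambda>s. N (U n (x + \<sigma> * (t - s)) s) s)"
      using W_Suc_from[OF assms(1), of "t - r" t n x] \<open>r < t\<close> \<open>0 < r\<close> by simp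
    also have "\<dots> \<le> integral {t - r..t} (\<lambda>s. N (U n x t) t)"
    proof (intro integral_le nonlin_char_integrable nonlin_mono U_ge integrable_const_ivl U_cone_mono)
      show "\<bar>x + \<sigma> * (t - s) - x\<bar> \<le> (1 + \<epsilon>) * (t - s)" if "s \<in> {t - r..t}" for s
        using that assms(1) \<epsilon>_pos by (simp add: abs_mult mult_right_mono[of 1 "1 + \<epsilon>", simplified])
    qed (use \<open>r < t\<close> in auto)
    also have "\<dots> = r * N (U n x t) t" using \<open>0 < r\<close> by simp
    finally have "W \<sigma> (Suc n) x t - W \<sigma> (Suc n) (x + \<sigma> * r) (t - r) \<le> r * N (U n x t) t" .
    moreover have "W \<sigma> (Suc n) (x + \<sigma> * r) (t - r) \<le> W \<sigma> (Suc n) x (t - h)"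
    proof (rule W_cone_mono'[OF assms(1)])
      have "0 < (1 + \<epsilon>) * (r - h)" using rh \<open>0 < r\<close> by linarith
      then have "h < r" using \<epsilon>_pos by (simp add: zero_less_mult_iff)
      then show "t - r \<le> t - h" by simp
      show "\<bar>x + \<sigma> * r - x\<bar> \<le> (1 + \<epsilon>) * (t - h - (t - r))"
        using assms(1) \<open>0 < r\<close> rh by (simp add: abs_mult)
    qed (use \<open>r < t\<close> in auto)
    ultimately show "W \<sigma> (Suc n) x t - W \<sigma> (Suc n) x (t - h) \<le> (1 + \<epsilon>) / \<epsilon> * N (U n x t) t * h"
      by (simp add: r_def mult_ac)
  qed
qed

subsection \<open>Picard contraction below a point of boundedness\<close>

text \<open>The wide cone below \<open>(x1, t1)\<close> inherits the bound \<open>M\<close> and is stable under backward characteristics,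
  so there the Picard iteration for values and space derivatives contracts in the sup norm
  weighted by \<open>exp (- K s)\<close>.\<close>

lemma cone_contraction:
  assumes M: "\<And>n. U n x1 t1 \<le> M" and "0 \<le> t1"
  obtains A K where "0 \<le> A" "0 < K"
    "\<And>n \<sigma> y s. \<bar>\<sigma>\<bar> = 1 \<Longrightarrow> 0 \<le> s \<Longrightarrow> s \<le> t1 \<Longrightarrow> \<bar>y - x1\<bar> \<le> (1 + \<epsilon>) * (t1 - s) \<Longrightarrow>
      \<bar>W \<sigma> (Suc n) y s - W \<sigma> n y s\<bar> \<le> A / 2 ^ n * exp (K * s) \<and>
      \<bar>V (Suc n) \<sigma> y s - V n \<sigma> y s\<bar> \<le> A / 2 ^ n * exp (K * s)"
proof -
  define cone where "cone y s \<longleftrightarrow> 0 \<le> s \<and> s \<le> t1 \<and> \<bar>y - x1\<bar> \<le> (1 + \<epsilon>) * (t1 - s)" for y s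
  have cone_back: "cone (y + \<sigma> * (t - s)) s" if "cone y t" "\<bar>\<sigma>\<bar> = 1" "s \<in> {0..t}" for y t \<sigma> s
  proof -
    have "\<bar>y + \<sigma> * (t - s) - x1\<bar> \<le> \<bar>y - x1\<bar> + \<bar>\<sigma> * (t - s)\<bar>" by linarith
    also have "\<bar>\<sigma> * (t - s)\<bar> = t - s" using that by (simp add: abs_mult)
    also have "\<bar>y - x1\<bar> + (t - s) \<le> (1 + \<epsilon>) * (t1 - t) + (1 + \<epsilon>) * (t - s)"
      using that \<epsilon>_pos by (intro add_mono) (auto simp: cone_def mult_right_mono[of 1 "1 + \<epsilon>", simplified])
    finally show ?thesis using that by (auto simp: cone_def algebra_simps)
  qed
  have U_range: "U n y s \<in> {\<gamma>..M}" if "cone y s" for n y s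
    using that U_ge[of s n y] U_cone_mono[of s t1 y x1 n] M[of n] by (auto simp: cone_def)
  have W_range: "0 \<le> W \<sigma> n y s" "W \<sigma> n y s \<le> M" if "cone y s" "\<bar>\<sigma>\<bar> = 1" for \<sigma> n y s
  proof -
    have nonneg: "0 \<le> W \<tau> n y s" if "\<bar>\<tau>\<bar> = 1" for \<tau>
      using W_ge[OF that, of s n y] \<Gamma>_pos[OF that] \<open>cone y s\<close> by (simp add: cone_def)
    show "0 \<le> W \<sigma> n y s" by (rule nonneg[OF that(2)])
    have "\<sigma> = 1 \<or> \<sigma> = -1" using that(2) by linarith
    then show "W \<sigma> n y s \<le> M"
      using nonneg[of 1] nonneg[of "-1"] U_range[OF that(1), of n] by (auto simp: U_def)
  qed
  obtain L where L: "0 < L"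
    "\<And>u v s. u \<in> {\<gamma>..M} \<Longrightarrow> v \<in> {\<gamma>..M} \<Longrightarrow> 0 \<le> s \<Longrightarrow> \<bar>N u s - N v s\<bar> \<le> L * \<bar>u - v\<bar>"
    "\<And>u v s. u \<in> {\<gamma>..M} \<Longrightarrow> v \<in> {\<gamma>..M} \<Longrightarrow> 0 \<le> s \<Longrightarrow> \<bar>dN u s - dN v s\<bar> \<le> L * \<bar>u - v\<bar>"
    "\<And>u s. u \<in> {\<gamma>..M} \<Longrightarrow> 0 \<le> s \<Longrightarrow> \<bar>dN u s\<bar> \<le> L"
    using nonlin_Lipschitz[of M] by blast
  define V2 where "V2 n y s = V n 1 y s + V n (-1) y s" for n y s
  have V_Suc: "V (Suc n) \<sigma> y t = F' \<sigma> (y + \<sigma> * t)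
      + integral {0..t} (\<lambda>s. dN (U n (y + \<sigma> * (t - s)) s) s * V2 n (y + \<sigma> * (t - s)) s)" for n \<sigma> y t
    by (simp add: V2_def)
  have int_cont: "continuous_on {0..t} (\<lambda>s. dN (U n (y + \<sigma> * (t - s)) s) s * V2 n (y + \<sigma> * (t - s)) s)"
    for n \<sigma> y t
    unfolding V2_def
    by (rule continuous_on_halfplane_compose[OF dN_V_continuous]) (auto intro!: continuous_intros)
  define B0 where "B0 = N \<gamma> 0"
  have "0 \<le> B0" by (simp add: B0_def nonlin_nonneg)
  have F'_le: "\<bar>F' \<sigma> y\<bar> \<le> B0" if "\<bar>\<sigma>\<bar> = 1" for \<sigma> y
  proof -
    have "1 * \<bar>F' \<sigma> y\<bar> \<le> (2 + \<epsilon>) * \<bar>F' \<sigma> y\<bar>" using \<epsilon>_pos by (intro mult_right_mono) auto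
    also have "\<dots> \<le> B0"
      using F'_small[OF that, of y] \<gamma>_pos by (simp add: B0_def nonlin_def \<gamma>_def)
    finally show ?thesis by simp
  qed
  \<comment> \<open>A uniform bound on the space derivatives has to precede the contraction, since
    the difference of two \<open>V\<close>-iterates contains the difference of the \<open>dN\<close>
    terms multiplied by \<open>V2 n\<close>.\<close>
  have V_exp: "\<bar>V n \<sigma> y t\<bar> \<le> B0 * exp (2 * L * t)" if "cone y t" "\<bar>\<sigma>\<bar> = 1" for n \<sigma> y t
    using that
  proof (induction n arbitrary: \<sigma> y t)
    case 0
    then show ?case using \<open>0 \<le> B0\<close> by simp
  next
    case (Suc n)
    have "0 \<le> t" using Suc.prems by (simp add: cone_def)
    have "\<bar>integral {0..t} (\<lambda>s. dN (U n (y + \<sigma> * (t - s)) s) s * V2 n (y + \<sigma> * (t - s)) s)\<bar>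
        \<le> 2 * L * B0 / (2 * L) * exp (2 * L * t) - 2 * L * B0 / (2 * L)"
    proof (rule abs_integral_le_exp[OF int_cont \<open>0 \<le> t\<close>])
      fix s assume s: "s \<in> {0..t}"
      have c: "cone (y + \<sigma> * (t - s)) s" by (rule cone_back[OF Suc.prems s])
      have "\<bar>V2 n (y + \<sigma> * (t - s)) s\<bar> \<le> 2 * B0 * exp (2 * L * s)"
        unfolding V2_def using Suc.IH[OF c, of 1] Suc.IH[OF c, of "-1"] by simp
      moreover have "\<bar>dN (U n (y + \<sigma> * (t - s)) s) s\<bar> \<le> L"
        by (rule L(4)[OF U_range[OF c]]) (use s in auto)
      ultimately have "\<bar>dN (U n (y + \<sigma> * (t - s)) s) s\<bar> * \<bar>V2 n (y + \<sigma> * (t - s)) s\<bar>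
          \<le> L * (2 * B0 * exp (2 * L * s))"
        using L(1) by (intro mult_mono) auto
      then show "\<bar>dN (U n (y + \<sigma> * (t - s)) s) s * V2 n (y + \<sigma> * (t - s)) s\<bar>
          \<le> 2 * L * B0 * exp (2 * L * s)"
        by (simp add: abs_mult mult_ac)
    qed (use L \<open>0 \<le> B0\<close> in auto)
    also have "2 * L * B0 / (2 * L) = B0" using L(1) by simp
    finally show ?case
      unfolding V_Suc using F'_le[OF Suc.prems(2), of "y + \<sigma> * t"] by linarith
  qed
  define B where "B = B0 * exp (2 * L * t1)"
  have "0 \<le> B" using \<open>0 \<le> B0\<close> by (simp add: B_def)
  have V_le: "\<bar>V n \<sigma> y t\<bar> \<le> B" if "cone y t" "\<bar>\<sigma>\<bar> = 1" for n \<sigma> y t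
  proof -
    have "B0 * exp (2 * L * t) \<le> B"
      unfolding B_def using \<open>0 \<le> B0\<close> L(1) that by (intro mult_left_mono) (auto simp: cone_def)
    with V_exp[OF that, of n] show ?thesis by linarith
  qed
  \<comment> \<open>The product rule bounds the new error by \<open>2 * L * (1 + 2 * B)\<close>
    times the old one, and integrating the weight divides by \<open>K\<close>; this choice makes the
    quotient one half.\<close>
  define K where "K = 4 * L * (1 + 2 * B)"
  have "0 < K" using L(1) \<open>0 \<le> B\<close> by (simp add: K_def)
  define A where "A = M + B"
  have "0 \<le> M" using M[of 0] U_ge[OF \<open>0 \<le> t1\<close>, of 0 x1] \<gamma>_pos by linarith
  then have "0 \<le> A" using \<open>0 \<le> B\<close> by (simp add: A_def)
  have main: "\<bar>W \<sigma> (Suc n) y t - W \<sigma> n y t\<bar> \<le> A / 2 ^ n * exp (K * t) \<and>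
      \<bar>V (Suc n) \<sigma> y t - V n \<sigma> y t\<bar> \<le> A / 2 ^ n * exp (K * t)"
    if "cone y t" "\<bar>\<sigma>\<bar> = 1" for n \<sigma> y t
    using that
  proof (induction n arbitrary: \<sigma> y t)
    case 0
    have "1 \<le> exp (K * t)" using 0 \<open>0 < K\<close> by (simp add: cone_def)
    then have "A * 1 \<le> A * exp (K * t)" using \<open>0 \<le> A\<close> by (rule mult_left_mono)
    moreover have "\<bar>W \<sigma> (Suc 0) y t - W \<sigma> 0 y t\<bar> \<le> M"
      using W_range[OF 0, of 0] W_range[OF 0, of "Suc 0"] by linarith
    moreover have "\<bar>V (Suc 0) \<sigma> y t - V 0 \<sigma> y t\<bar> \<le> B"
      using V_le[OF 0, of "Suc 0"] by simp
    ultimately show ?case using \<open>0 \<le> M\<close> \<open>0 \<le> B\<close> by (simp add: A_def)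
  next
    case (Suc n)
    have "0 \<le> t" using Suc.prems by (simp add: cone_def)
    define e where "e = A / 2 ^ n"
    have "0 \<le> e" using \<open>0 \<le> A\<close> by (simp add: e_def)
    have dU: "\<bar>U (Suc n) y s - U n y s\<bar> \<le> 2 * e * exp (K * s)"
      and dV: "\<bar>V2 (Suc n) y s - V2 n y s\<bar> \<le> 2 * e * exp (K * s)" if "cone y s" for y s
      using Suc.IH[OF that, of 1] Suc.IH[OF that, of "-1"] unfolding U_def V2_def e_def
      by (simp_all del: V.simps, linarith+)
    have half: "2 * L * (1 + 2 * B) * e / K = A / 2 ^ Suc n"
    proof -
      have "2 * L * b * e / (4 * L * b) = e / 2" if "0 < b" for b
        using L(1) that by simp
      from this[of "1 + 2 * B"] \<open>0 \<le> B\<close> show ?thesis by (simp add: K_def e_def)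
    qed
    have "0 \<le> A / 2 ^ Suc n" using \<open>0 \<le> A\<close> by simp
    have "\<bar>integral {0..t} (\<lambda>s. N (U (Suc n) (y + \<sigma> * (t - s)) s) s - N (U n (y + \<sigma> * (t - s)) s) s)\<bar>
        \<le> 2 * L * (1 + 2 * B) * e / K * exp (K * t) - 2 * L * (1 + 2 * B) * e / K"
    proof (rule abs_integral_le_exp[OF _ \<open>0 \<le> t\<close> \<open>0 < K\<close>])
      fix s assume s: "s \<in> {0..t}"
      have c: "cone (y + \<sigma> * (t - s)) s" by (rule cone_back[OF Suc.prems s])
      have "\<bar>N (U (Suc n) (y + \<sigma> * (t - s)) s) s - N (U n (y + \<sigma> * (t - s)) s) s\<bar>
          \<le> L * \<bar>U (Suc n) (y + \<sigma> * (t - s)) s - U n (y + \<sigma> * (t - s)) s\<bar>"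
        by (rule L(2)) (use U_range[OF c] s in auto)
      also have "\<dots> \<le> L * (2 * e * exp (K * s))"
        using L(1) dU[OF c] by simp
      \<comment> \<open>The factor \<open>1 + 2 * B\<close> is inserted so that values and space
        derivatives share one contraction constant.\<close>
      also have "\<dots> \<le> L * (2 * e * exp (K * s)) * (1 + 2 * B)"
        using L(1) \<open>0 \<le> e\<close> \<open>0 \<le> B\<close> by (intro mult_left_mono[of 1 "1 + 2 * B", simplified mult_1_right]) auto
      finally show "\<bar>N (U (Suc n) (y + \<sigma> * (t - s)) s) s - N (U n (y + \<sigma> * (t - s)) s) s\<bar>
          \<le> 2 * L * (1 + 2 * B) * e * exp (K * s)"
        by (simp only: mult_ac)
    qed (use L(1) \<open>0 \<le> B\<close> \<open>0 \<le> e\<close> in \<open>auto intro!: continuous_intros nonlin_char_continuous\<close>)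
    also have "integral {0..t} (\<lambda>s. N (U (Suc n) (y + \<sigma> * (t - s)) s) s - N (U n (y + \<sigma> * (t - s)) s) s)
        = W \<sigma> (Suc (Suc n)) y t - W \<sigma> (Suc n) y t"
      unfolding W_Suc[OF Suc.prems(2)]
      by (subst Henstock_Kurzweil_Integration.integral_diff) (auto intro: nonlin_char_integrable)
    finally have W: "\<bar>W \<sigma> (Suc (Suc n)) y t - W \<sigma> (Suc n) y t\<bar> \<le> A / 2 ^ Suc n * exp (K * t)"
      unfolding half using \<open>0 \<le> A / 2 ^ Suc n\<close> by linarith
    have "\<bar>integral {0..t} (\<lambda>s. dN (U (Suc n) (y + \<sigma> * (t - s)) s) s * V2 (Suc n) (y + \<sigma> * (t - s)) s
           - dN (U n (y + \<sigma> * (t - s)) s) s * V2 n (y + \<sigma> * (t - s)) s)\<bar>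
        \<le> 2 * L * (1 + 2 * B) * e / K * exp (K * t) - 2 * L * (1 + 2 * B) * e / K"
    proof (rule abs_integral_le_exp[OF _ \<open>0 \<le> t\<close> \<open>0 < K\<close>])
      fix s assume s: "s \<in> {0..t}"
      define z where "z = y + \<sigma> * (t - s)"
      have c: "cone z s" unfolding z_def by (rule cone_back[OF Suc.prems s])
      have "\<bar>V2 n z s\<bar> \<le> 2 * B"
        unfolding V2_def using V_le[OF c, of 1 n] V_le[OF c, of "-1" n] by simp
      moreover have "\<bar>dN (U (Suc n) z s) s - dN (U n z s) s\<bar> \<le> L * (2 * e * exp (K * s))"
      proof -
        have "\<bar>dN (U (Suc n) z s) s - dN (U n z s) s\<bar> \<le> L * \<bar>U (Suc n) z s - U n z s\<bar>"
          by (rule L(3)) (use U_range[OF c] s in auto)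
        also have "\<dots> \<le> L * (2 * e * exp (K * s))"
          using L(1) dU[OF c] by simp
        finally show ?thesis .
      qed
      ultimately have 1: "\<bar>dN (U (Suc n) z s) s - dN (U n z s) s\<bar> * \<bar>V2 n z s\<bar>
          \<le> L * (2 * e * exp (K * s)) * (2 * B)"
        using L(1) \<open>0 \<le> e\<close> by (intro mult_mono) auto
      have "\<bar>dN (U (Suc n) z s) s\<bar> \<le> L"
        by (rule L(4)[OF U_range[OF c]]) (use s in auto)
      then have 2: "\<bar>dN (U (Suc n) z s) s\<bar> * \<bar>V2 (Suc n) z s - V2 n z s\<bar> \<le> L * (2 * e * exp (K * s))"
        using L(1) dV[OF c] by (intro mult_mono) auto
      have "dN (U (Suc n) z s) s * V2 (Suc n) z s - dN (U n z s) s * V2 n z s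
          = dN (U (Suc n) z s) s * (V2 (Suc n) z s - V2 n z s)
            + (dN (U (Suc n) z s) s - dN (U n z s) s) * V2 n z s"
        by (simp add: algebra_simps)
      then have "\<bar>dN (U (Suc n) z s) s * V2 (Suc n) z s - dN (U n z s) s * V2 n z s\<bar>
          \<le> \<bar>dN (U (Suc n) z s) s\<bar> * \<bar>V2 (Suc n) z s - V2 n z s\<bar>
            + \<bar>dN (U (Suc n) z s) s - dN (U n z s) s\<bar> * \<bar>V2 n z s\<bar>"
        by (metis abs_mult abs_triangle_ineq)
      also have "\<dots> \<le> L * (2 * e * exp (K * s)) + L * (2 * e * exp (K * s)) * (2 * B)"
        by (rule add_mono[OF 2 1])
      finally show "\<bar>dN (U (Suc n) (y + \<sigma> * (t - s)) s) s * V2 (Suc n) (y + \<sigma> * (t - s)) s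
           - dN (U n (y + \<sigma> * (t - s)) s) s * V2 n (y + \<sigma> * (t - s)) s\<bar>
          \<le> 2 * L * (1 + 2 * B) * e * exp (K * s)"
        unfolding z_def[symmetric] by (simp add: algebra_simps)
    qed (use L(1) \<open>0 \<le> B\<close> \<open>0 \<le> e\<close> in \<open>auto intro!: continuous_on_diff int_cont\<close>)
    also have "integral {0..t} (\<lambda>s. dN (U (Suc n) (y + \<sigma> * (t - s)) s) s * V2 (Suc n) (y + \<sigma> * (t - s)) s
           - dN (U n (y + \<sigma> * (t - s)) s) s * V2 n (y + \<sigma> * (t - s)) s)
        = V (Suc (Suc n)) \<sigma> y t - V (Suc n) \<sigma> y t"
      unfolding V_Suc
      by (subst Henstock_Kurzweil_Integration.integral_diff)
         (auto intro: integrable_continuous_real int_cont simp del: V.simps)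
    finally have "\<bar>V (Suc (Suc n)) \<sigma> y t - V (Suc n) \<sigma> y t\<bar> \<le> A / 2 ^ Suc n * exp (K * t)"
      unfolding half using \<open>0 \<le> A / 2 ^ Suc n\<close> by linarith
    with W show ?case by blast
  qed
  show ?thesis
    by (rule that[OF \<open>0 \<le> A\<close> \<open>0 < K\<close>], rule main) (auto simp: cone_def)
qed

subsection \<open>The limit and its time derivative\<close>

lemma W_le_U:
  assumes "\<bar>\<sigma>\<bar> = 1" "0 \<le> t"
  shows "W \<sigma> n x t \<le> U n x t"
proof -
  have "\<sigma> = 1 \<or> \<sigma> = -1" using assms(1) by linarith
  then show ?thesis
    using W_ge[of 1 t n x] W_ge[of "-1" t n x] \<Gamma>_pos[of 1] \<Gamma>_pos[of "-1"] assms(2)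
    by (auto simp: U_def)
qed

text \<open>Where the iterates are unbounded, \<open>lim\<close> carries no information; each use is
  therefore backed by a bound on \<open>U\<close>.\<close>

definition WL :: "real \<Rightarrow> real \<Rightarrow> real \<Rightarrow> real" where
  "WL \<sigma> x t = lim (\<lambda>n. W \<sigma> n x t)"

definition UL :: "real \<Rightarrow> real \<Rightarrow> real" where
  "UL x t = WL 1 x t + WL (-1) x t"

lemma W_tendsto:
  assumes "\<And>n. U n x t \<le> M" "0 \<le> t" "\<bar>\<sigma>\<bar> = 1"
  shows "(\<lambda>n. W \<sigma> n x t) \<longlonglongrightarrow> WL \<sigma> x t"
proof -
  have "\<forall>n. W \<sigma> n x t \<le> M"
    using W_le_U[OF assms(3,2)] assms(1) by (meson order_trans)
  then obtain l where "(\<lambda>n. W \<sigma> n x t) \<longlonglongrightarrow> l"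
    using incseq_convergent[OF W_incseq[OF assms(3,2)]] by blast
  then show ?thesis unfolding WL_def by (simp add: limI)
qed

lemma U_tendsto:
  assumes "\<And>n. U n x t \<le> M" "0 \<le> t"
  shows "(\<lambda>n. U n x t) \<longlonglongrightarrow> UL x t"
  unfolding U_def UL_def using W_tendsto[OF assms] by (intro tendsto_add) auto

lemma U_le_of_le:
  assumes "\<And>n. U n x t \<le> M" "0 \<le> s" "s \<le> t"
  shows "U n x s \<le> M"
  using U_cone_mono[of s t x x n] assms(1)[of n] assms(2,3) \<epsilon>_pos by simp

lemma U_le_UL:
  assumes "\<And>n. U n x t \<le> M" "0 \<le> t"
  shows "U n x t \<le> UL x t"
  by (rule incseq_le[OF U_incseq[OF assms(2)] U_tendsto[OF assms]])

lemma UL_ge: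
  assumes "\<And>n. U n x t \<le> M" "0 \<le> t"
  shows "\<gamma> \<le> UL x t"
  using U_le_UL[OF assms, of 0] U_ge[OF assms(2), of 0 x] by linarith

text \<open>The vertical segment below \<open>(x, t1)\<close> lies in the cone of
  \<open>cone_contraction\<close>, so the time derivatives converge uniformly on it and the limit
  may be differentiated. The two bounds, being weak inequalities for each iterate, survive the
  limit. Boundedness at a later time \<open>t1\<close> provides a two-sided neighbourhood of
  \<open>t\<close>.\<close>

lemma WL_deriv_t:
  assumes M: "\<And>n. U n x t1 \<le> M" and "\<bar>\<sigma>\<bar> = 1" "0 < t" "t < t1"
  obtains D where "((\<lambda>t. WL \<sigma> x t) has_real_derivative D) (at t)"
    "N (UL x t) t / 2 \<le> D" "D \<le> (1 + \<epsilon>) / \<epsilon> * N (UL x t) t"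
proof -
  define S where "S = {0<..<t1}"
  have "0 \<le> t1" using assms by simp
  obtain A K where AK: "0 \<le> A" "0 < K" and
    contr: "\<And>n \<sigma> y s. \<bar>\<sigma>\<bar> = 1 \<Longrightarrow> 0 \<le> s \<Longrightarrow> s \<le> t1 \<Longrightarrow> \<bar>y - x\<bar> \<le> (1 + \<epsilon>) * (t1 - s) \<Longrightarrow>
      \<bar>W \<sigma> (Suc n) y s - W \<sigma> n y s\<bar> \<le> A / 2 ^ n * exp (K * s) \<and>
      \<bar>V (Suc n) \<sigma> y s - V n \<sigma> y s\<bar> \<le> A / 2 ^ n * exp (K * s)"
    using cone_contraction[OF M \<open>0 \<le> t1\<close>] by blast
  define E where "E = A * exp (K * t1)"
  have contr': "\<bar>W \<tau> (Suc n) x s - W \<tau> n x s\<bar> \<le> E / 2 ^ n"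
    "\<bar>V (Suc n) \<tau> x s - V n \<tau> x s\<bar> \<le> E / 2 ^ n" if "s \<in> S" "\<bar>\<tau>\<bar> = 1" for n s \<tau>
  proof -
    have "A / 2 ^ n * exp (K * s) \<le> A / 2 ^ n * exp (K * t1)"
      using that AK by (intro mult_left_mono) (auto simp: S_def)
    then have "A / 2 ^ n * exp (K * s) \<le> E / 2 ^ n" by (simp add: E_def)
    moreover have "\<bar>W \<tau> (Suc n) x s - W \<tau> n x s\<bar> \<le> A / 2 ^ n * exp (K * s) \<and>
        \<bar>V (Suc n) \<tau> x s - V n \<tau> x s\<bar> \<le> A / 2 ^ n * exp (K * s)"
      by (rule contr) (use that \<epsilon>_pos in \<open>auto simp: S_def\<close>)
    ultimately show "\<bar>W \<tau> (Suc n) x s - W \<tau> n x s\<bar> \<le> E / 2 ^ n"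
      "\<bar>V (Suc n) \<tau> x s - V n \<tau> x s\<bar> \<le> E / 2 ^ n"
      by (meson order_trans)+
  qed
  obtain L where L: "0 < L"
    "\<And>u v s. u \<in> {\<gamma>..M} \<Longrightarrow> v \<in> {\<gamma>..M} \<Longrightarrow> 0 \<le> s \<Longrightarrow> \<bar>N u s - N v s\<bar> \<le> L * \<bar>u - v\<bar>"
    "\<And>u v s. u \<in> {\<gamma>..M} \<Longrightarrow> v \<in> {\<gamma>..M} \<Longrightarrow> 0 \<le> s \<Longrightarrow> \<bar>dN u s - dN v s\<bar> \<le> L * \<bar>u - v\<bar>"
    "\<And>u s. u \<in> {\<gamma>..M} \<Longrightarrow> 0 \<le> s \<Longrightarrow> \<bar>dN u s\<bar> \<le> L"
    using nonlin_Lipschitz[of M] by blast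
  define D where "D n s = \<sigma> * V (Suc n) \<sigma> x s + N (U n x s) s" for n s
  have "\<bar>D (Suc n) s - D n s\<bar> \<le> (E + 2 * L * E) / 2 ^ n" if "s \<in> S" for n s
  proof -
    have s: "0 \<le> s" "s \<le> t1" using that by (auto simp: S_def)
    have "\<bar>\<sigma> * (V (Suc (Suc n)) \<sigma> x s - V (Suc n) \<sigma> x s)\<bar> \<le> E / 2 ^ Suc n"
      using contr'(2)[OF that assms(2), of "Suc n"] assms(2) by (simp add: abs_mult del: V.simps power_Suc)
    also have "\<dots> \<le> E / 2 ^ n"
      using AK(1) by (simp add: E_def field_simps)
    finally have 1: "\<bar>\<sigma> * (V (Suc (Suc n)) \<sigma> x s - V (Suc n) \<sigma> x s)\<bar> \<le> E / 2 ^ n" .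
    have "\<bar>N (U (Suc n) x s) s - N (U n x s) s\<bar> \<le> L * \<bar>U (Suc n) x s - U n x s\<bar>"
      using U_ge[OF s(1), of _ x] U_le_of_le[OF M s] s by (intro L(2)) auto
    also have "\<dots> \<le> L * (2 * (E / 2 ^ n))"
      using contr'(1)[OF that, of 1 n] contr'(1)[OF that, of "-1" n] L(1)
      by (intro mult_left_mono) (auto simp: U_def)
    finally have "\<bar>N (U (Suc n) x s) s - N (U n x s) s\<bar> \<le> L * (2 * (E / 2 ^ n))" .
    moreover have "D (Suc n) s - D n s = \<sigma> * (V (Suc (Suc n)) \<sigma> x s - V (Suc n) \<sigma> x s)
        + (N (U (Suc n) x s) s - N (U n x s) s)"
      by (simp add: D_def right_diff_distrib del: V.simps)
    ultimately have "\<bar>D (Suc n) s - D n s\<bar> \<le> E / 2 ^ n + L * (2 * (E / 2 ^ n))"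
      using 1 by linarith
    then show ?thesis by (simp add: add_divide_distrib mult_ac)
  qed
  \<comment> \<open>The error bound does not depend on \<open>s\<close>: this is the uniform
    convergence of the derivatives.\<close>
  then have "\<forall>s\<in>S. \<exists>l. (\<lambda>n. D n s) \<longlonglongrightarrow> l \<and> (\<forall>n. \<bar>D n s - l\<bar> \<le> 2 * (E + 2 * L * E) / 2 ^ n)"
    by (metis geometric_Cauchy_limit)
  then obtain G where G: "\<And>s. s \<in> S \<Longrightarrow> (\<lambda>n. D n s) \<longlonglongrightarrow> G s"
    "\<And>s n. s \<in> S \<Longrightarrow> \<bar>D n s - G s\<bar> \<le> 2 * (E + 2 * L * E) / 2 ^ n"
    by metis
  have "t \<in> S" using assms by (simp add: S_def)
  have lim: "(\<lambda>n. W \<sigma> n x s) \<longlonglongrightarrow> WL \<sigma> x s" if "s \<in> S" for s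
    using that assms(2) U_le_of_le[OF M] by (intro W_tendsto[of x s M]) (auto simp: S_def)
  have Dn: "((\<lambda>t. W \<sigma> (Suc n) x t) has_real_derivative D n s) (at s)" if "s \<in> S" for n s
    unfolding D_def using W_deriv_t[OF assms(2)] that by (simp add: S_def del: V.simps)
  have "\<exists>g. \<forall>s\<in>S. (\<lambda>n. W \<sigma> (Suc n) x s) \<longlonglongrightarrow> g s \<and> (g has_derivative (*) (G s)) (at s within S)"
  proof (rule has_derivative_sequence[where f' = "\<lambda>n s. (*) (D n s)"])
    show "convex S" by (simp add: S_def)
    show "(W \<sigma> (Suc n) x has_derivative (*) (D n s)) (at s within S)" if "s \<in> S" for n s
      using Dn[OF that] by (simp add: has_field_derivative_def has_derivative_at_withinI)
    show "(\<lambda>n. W \<sigma> (Suc n) x t) \<longlonglongrightarrow> WL \<sigma> x t"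
      using lim[OF \<open>t \<in> S\<close>] by (rule LIMSEQ_Suc)
    fix e :: real
    assume "0 < e"
    have "(\<lambda>n. 2 * (E + 2 * L * E) / 2 ^ n) \<longlonglongrightarrow> 0"
      by (rule LIMSEQ_divide_realpow_zero) simp
    then have "\<forall>\<^sub>F n in sequentially. 2 * (E + 2 * L * E) / 2 ^ n < e"
      by (rule order_tendstoD(2)) fact
    then show "\<forall>\<^sub>F n in sequentially. \<forall>s\<in>S. \<forall>h. norm (D n s * h - G s * h) \<le> e * norm h"
    proof eventually_elim
      case (elim n)
      have "\<bar>D n s - G s\<bar> * \<bar>h\<bar> \<le> e * \<bar>h\<bar>" if "s \<in> S" for s h
        using G(2)[OF that, of n] elim by (intro mult_right_mono) auto
      then show ?case by (simp add: abs_mult flip: left_diff_distrib)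
    qed
  qed fact
  then obtain g where g: "\<And>s. s \<in> S \<Longrightarrow> (\<lambda>n. W \<sigma> (Suc n) x s) \<longlonglongrightarrow> g s"
    "\<And>s. s \<in> S \<Longrightarrow> (g has_derivative (*) (G s)) (at s within S)" by blast
  have g_eq: "g s = WL \<sigma> x s" if "s \<in> S" for s
    using g(1)[OF that] LIMSEQ_Suc[OF lim[OF that]] by (rule LIMSEQ_unique)
  have "(g has_real_derivative G t) (at t)"
    using g(2)[OF \<open>t \<in> S\<close>] \<open>t \<in> S\<close> at_within_open[of t S]
    by (simp add: has_field_derivative_def S_def)
  then have deriv: "((\<lambda>t. WL \<sigma> x t) has_real_derivative G t) (at t)"
    by (rule has_field_derivative_transform_within_open[of _ _ _ S])
       (use \<open>t \<in> S\<close> g_eq in \<open>auto simp: S_def\<close>)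
  have M': "\<And>n. U n x t \<le> M" using U_le_of_le[OF M] assms by simp
  have "0 < UL x t" using UL_ge[OF M'] assms \<gamma>_pos by force
  then have "isCont (\<lambda>u. N u t) (UL x t)"
    using nonlin_deriv DERIV_isCont by blast
  then have limN: "(\<lambda>n. N (U n x t) t) \<longlonglongrightarrow> N (UL x t) t"
    using U_tendsto[OF M'] assms by (intro isCont_tendsto_compose[where g = "\<lambda>u. N u t"]) auto
  show ?thesis
  proof (rule that[OF deriv])
    show "N (UL x t) t / 2 \<le> G t"
      using W_deriv_t_ge[OF assms(2,3) Dn[OF \<open>t \<in> S\<close>]]
      by (intro LIMSEQ_le[OF tendsto_divide[OF limN tendsto_const] G(1)[OF \<open>t \<in> S\<close>]]) auto
    show "G t \<le> (1 + \<epsilon>) / \<epsilon> * N (UL x t) t"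
      using W_deriv_t_le[OF assms(2,3) Dn[OF \<open>t \<in> S\<close>]]
      by (intro LIMSEQ_le[OF G(1)[OF \<open>t \<in> S\<close>] tendsto_mult[OF tendsto_const limN]]) auto
  qed
qed

text \<open>A bound at \<open>(x, t)\<close> controls the wide cone below it; within a time \<open>h\<close> of order
  \<open>M powr (1 - p)\<close> the light cone below \<open>(x, t + h)\<close> leaves the controlled region only
  for a short time, on which the iterates cannot grow much.\<close>

lemma U_extend:
  assumes M: "\<And>n. U n x t \<le> M" and "0 \<le> t" "0 < h"
    and small: "(h + h / \<epsilon>) * 3 powr p * M powr (p - 1) \<le> 1"
  shows "U n x (t + h) \<le> 6 * M"
proof -
  \<comment> \<open>For this \<open>k\<close> the light cone below \<open>(x, t + h)\<close> and the
    wide cone below \<open>(x, t)\<close> have the same radius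
    \<open>h + k = (1 + \<epsilon>) * k\<close> at time \<open>t - k\<close>; from there down the
    light cone lies inside the wide one.\<close>
  define k where "k = h / \<epsilon>"
  have "0 < k" using assms \<epsilon>_pos by (simp add: k_def)
  have hk: "h + k = (1 + \<epsilon>) * k" using \<epsilon>_pos by (simp add: k_def field_simps)
  define r where "r = max 0 (t - k)"
  have r: "0 \<le> r" "r \<le> t" "t + h - r \<le> h + k" using \<open>0 < k\<close> assms(2) by (auto simp: r_def)
  have "\<gamma> \<le> M" using M[of 0] U_ge[OF \<open>0 \<le> t\<close>, of 0 x] by linarith
  then have "0 < M" using \<gamma>_pos by linarith
  have small': "(h + k) * (3 powr p * M powr p) \<le> M"
  proof -
    have "M powr p = M * M powr (p - 1)" using \<open>0 < M\<close> by (simp add: powr_diff)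
    then have "(h + k) * (3 powr p * M powr p) = (h + h / \<epsilon>) * 3 powr p * M powr (p - 1) * M"
      by (simp add: k_def)
    also have "\<dots> \<le> 1 * M" using small \<open>0 < M\<close> by (intro mult_right_mono) auto
    finally show ?thesis by simp
  qed
  have base: "W \<sigma> m y r \<le> 2 * M" if "\<bar>\<sigma>\<bar> = 1" "\<bar>y - x\<bar> \<le> t + h - r" for \<sigma> m y
  proof (cases "k \<le> t")
    case True
    have "W \<sigma> m y r \<le> W \<sigma> m x t"
      using that True r hk by (intro W_cone_mono') (auto simp: r_def max_def split: if_splits)
    also have "\<dots> \<le> M" using W_le_U[OF that(1) \<open>0 \<le> t\<close>] M by (meson order_trans)
    finally show ?thesis using \<open>0 < M\<close> by linarith
  next
    \<comment> \<open>Here the strip reaches the initial line and the data take over. Their slope is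
      at most \<open>N \<gamma> 0\<close>, hence at most \<open>3 powr p * M powr p\<close>, and
      over a distance of at most \<open>h + k\<close> they change by no more than
      \<open>M\<close>.\<close>
    case False
    then have "r = 0" by (simp add: r_def)
    have W1: "W \<sigma> (Suc j) z 0 = F \<sigma> z" for j z
      by (simp add: W_Suc[OF that(1)])
    have F_x: "F \<sigma> x \<le> M"
    proof -
      have "F \<sigma> x \<le> W \<sigma> (Suc 0) x t"
        using W_cone_mono'[OF that(1), of 0 t x x "Suc 0"] \<open>0 \<le> t\<close> \<epsilon>_pos by (simp add: W1)
      also have "\<dots> \<le> U (Suc 0) x t" by (rule W_le_U[OF that(1) \<open>0 \<le> t\<close>])
      also have "\<dots> \<le> M" by (rule M)
      finally show ?thesis .
    qed
    have "N \<gamma> 0 \<le> 2 powr (-p) * \<gamma> powr p" by (rule nonlin_upper) auto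
    also have "\<dots> \<le> 3 powr p * M powr p"
    proof (intro mult_mono powr_mono2)
      have "2 powr (-p) \<le> (1 :: real)" using p_gt_1 by (simp add: powr_minus ge_one_powr_ge_zero inverse_le_1_iff)
      also have "1 \<le> 3 powr p" using p_gt_1 by (intro ge_one_powr_ge_zero) auto
      finally show "2 powr (-p) \<le> 3 powr p" .
    qed (use p_gt_1 \<gamma>_pos \<open>\<gamma> \<le> M\<close> in auto)
    finally have "N \<gamma> 0 * \<bar>y - x\<bar> \<le> 3 powr p * M powr p * (h + k)"
      using that(2) r(3) by (intro mult_mono) auto
    moreover have "1 * \<bar>F \<sigma> y - F \<sigma> x\<bar> \<le> (2 + \<epsilon>) * \<bar>F \<sigma> y - F \<sigma> x\<bar>"
      using \<epsilon>_pos by (intro mult_right_mono) auto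
    ultimately have "\<bar>F \<sigma> y - F \<sigma> x\<bar> \<le> M"
      using F_Lipschitz[OF that(1), of y x] small' by (simp add: mult_ac)
    then have "F \<sigma> y \<le> 2 * M" using F_x by linarith
    moreover have "W \<sigma> 0 y 0 \<le> F \<sigma> y" using F_ge[OF that(1)] by (simp add: W_0[OF that(1)])
    ultimately show ?thesis
      using \<open>r = 0\<close> by (cases m) (auto simp: W1)
  qed
  \<comment> \<open>Bootstrap: \<open>2 * M\<close> from the base and at most \<open>M\<close> from
    the integral. If both components stay below \<open>3 * M\<close>, then \<open>N\<close> is at
    most \<open>2 powr (-p) * (6 * M) powr p = 3 powr p * M powr p\<close>, the rate for which
    \<open>small'\<close> is stated.\<close>
  have "W \<sigma> n y s \<le> 3 * M" if "\<bar>\<sigma>\<bar> = 1" "r \<le> s" "s \<le> t + h" "\<bar>y - x\<bar> \<le> t + h - s" for \<sigma> y s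
    using that
  proof (induction n arbitrary: \<sigma> y s)
    case 0
    have "W \<sigma> 0 x t \<le> M" using W_le_U[OF 0(1) \<open>0 \<le> t\<close>] M by (meson order_trans)
    then show ?case using \<open>0 < M\<close> by (simp add: W_0[OF 0(1)])
  next
    case (Suc n)
    have dist: "\<bar>y + \<sigma> * (s - s') - x\<bar> \<le> t + h - s'" if "r \<le> s'" "s' \<le> s" for s'
    proof -
      have "\<bar>\<sigma> * (s - s')\<bar> = s - s'" using Suc.prems(1) that by (simp add: abs_mult)
      then show ?thesis using Suc.prems(4) by linarith
    qed
    have "integral {r..s} (\<lambda>s'. N (U n (y + \<sigma> * (s - s')) s') s') \<le> integral {r..s} (\<lambda>s'. 3 powr p * M powr p)"
    proof (intro integral_le nonlin_char_integrable integrable_const_ivl)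
      fix s' assume s': "s' \<in> {r..s}"
      have "U n (y + \<sigma> * (s - s')) s' \<le> 6 * M"
        using Suc.IH[of 1 s' "y + \<sigma> * (s - s')"] Suc.IH[of "-1" s' "y + \<sigma> * (s - s')"] s' dist[of s'] Suc.prems(3)
        by (simp add: U_def)
      then have "N (U n (y + \<sigma> * (s - s')) s') s' \<le> N (6 * M) s'"
        using s' r(1) by (intro nonlin_mono U_ge) auto
      also have "\<dots> \<le> 2 powr (-p) * (6 * M) powr p"
        using s' r(1) \<open>\<gamma> \<le> M\<close> \<open>0 < M\<close> by (intro nonlin_upper) auto
      also have "\<dots> = 3 powr p * M powr p"
      proof -
        have "(6 * M) powr p = 2 powr p * (3 powr p * M powr p)"
          using powr_mult[of 2 "3 * M" p] powr_mult[of 3 M p] \<open>0 < M\<close> by simp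
        then show ?thesis by (simp add: powr_minus)
      qed
      finally show "N (U n (y + \<sigma> * (s - s')) s') s' \<le> 3 powr p * M powr p" .
    qed (use r(1) in auto)
    also have "\<dots> = (s - r) * (3 powr p * M powr p)" using Suc.prems(2) by simp
    also have "\<dots> \<le> (h + k) * (3 powr p * M powr p)"
      using r(3) Suc.prems(3) by (intro mult_right_mono) auto
    also have "\<dots> \<le> M" by (rule small')
    finally show ?case
      using W_Suc_from[OF Suc.prems(1) r(1) Suc.prems(2), of n y] base[OF Suc.prems(1) dist[of r], of "Suc n"] Suc.prems(2)
      by linarith
  qed
  from this[of 1 "t + h" x] this[of "-1" "t + h" x] show ?thesis
    using r(2) assms(3) by (simp add: U_def)
qed

subsection \<open>Blow-up before \<open>T1\<close>\<close>

text \<open>\<open>v\<close> solves the spatially constant equation for the sum, hence the factor 2,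
  with the damping frozen at its initial strength. Freezing lowers the right-hand side, so
  \<open>v\<close> is a subsolution. The excess of \<open>v\<close> over the iterates is halved in
  each step, so the comparison runs through the iterates and presupposes no limit.\<close>

lemma ODE_comparison:
  assumes "0 \<le> S"
    and v_deriv: "\<And>s. s \<in> {0..S} \<Longrightarrow>
      (v has_real_derivative 2 * (2 powr (-p) * v s powr p - \<mu> / 2 * v s)) (at s within {0..S})"
    and v0: "v 0 = \<gamma>" and v_range: "\<And>s. s \<in> {0..S} \<Longrightarrow> v s \<in> {\<gamma>..M}"
  obtains c K where "\<And>n y t. t \<in> {0..S} \<Longrightarrow> v t - U n y t \<le> c / 2 ^ n * exp (K * t)"
proof -
  obtain L where L: "0 < L"
    "\<And>u v s. u \<in> {\<gamma>..M} \<Longrightarrow> v \<in> {\<gamma>..M} \<Longrightarrow> 0 \<le> s \<Longrightarrow> \<bar>N u s - N v s\<bar> \<le> L * \<bar>u - v\<bar>"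
    "\<And>u v s. u \<in> {\<gamma>..M} \<Longrightarrow> v \<in> {\<gamma>..M} \<Longrightarrow> 0 \<le> s \<Longrightarrow> \<bar>dN u s - dN v s\<bar> \<le> L * \<bar>u - v\<bar>"
    "\<And>u s. u \<in> {\<gamma>..M} \<Longrightarrow> 0 \<le> s \<Longrightarrow> \<bar>dN u s\<bar> \<le> L"
    using nonlin_Lipschitz[of M] by blast
  have "\<gamma> \<le> M" using v_range[of 0] \<open>0 \<le> S\<close> by simp
  then have "0 < M" using \<gamma>_pos by linarith
  have v_cont: "continuous_on {0..S} v"
    by (rule DERIV_continuous_on[OF v_deriv])
  have N_v_cont: "continuous_on {0..t} (\<lambda>s. N (v s) s)" if "t \<in> {0..S}" for t
  proof -
    have "continuous_on {0..t} v"
      by (rule continuous_on_subset[OF v_cont]) (use that in auto)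
    then show ?thesis
      unfolding nonlin_def using p_gt_1
      by (intro continuous_on_diff continuous_on_mult continuous_on_divide continuous_on_powr'
          continuous_on_rabs continuous_intros) auto
  qed
  have v_le: "v t \<le> \<gamma> + 2 * integral {0..t} (\<lambda>s. N (v s) s)" if "t \<in> {0..S}" for t
  proof -
    have "((\<lambda>s. 2 * (2 powr (-p) * v s powr p - \<mu> / 2 * v s)) has_integral v t - v 0) {0..t}"
    proof (rule fundamental_theorem_of_calculus)
      show "(v has_vector_derivative 2 * (2 powr (-p) * v s powr p - \<mu> / 2 * v s)) (at s within {0..t})"
        if "s \<in> {0..t}" for s
        unfolding has_real_derivative_iff_has_vector_derivative[symmetric]
        by (rule has_field_derivative_subset[OF v_deriv]) (use that \<open>t \<in> {0..S}\<close> in auto)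
    qed (use that in auto)
    moreover have "((\<lambda>s. 2 * N (v s) s) has_integral 2 * integral {0..t} (\<lambda>s. N (v s) s)) {0..t}"
      by (intro has_integral_mult_right integrable_integral integrable_continuous_real N_v_cont that)
    moreover have "2 * (2 powr (-p) * v s powr p - \<mu> / 2 * v s) \<le> 2 * N (v s) s" if "s \<in> {0..t}" for s
    proof -
      have "0 < v s" using v_range[of s] that \<open>t \<in> {0..S}\<close> \<gamma>_pos by auto
      then have "\<mu> / (1 + s) / 2 * v s \<le> \<mu> / 2 * v s"
        using damping_le[of s] that by (intro mult_right_mono) auto
      then show ?thesis using \<open>0 < v s\<close> by (simp add: nonlin_def mult_ac)
    qed
    ultimately have "v t - v 0 \<le> 2 * integral {0..t} (\<lambda>s. N (v s) s)"
      by (rule has_integral_le)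
    then show ?thesis using v0 by simp
  qed
  \<comment> \<open>Each component contributes \<open>L / K\<close>, a quarter of the previous
    error; together they halve it.\<close>
  define K where "K = 4 * L"
  have "0 < K" using L(1) by (simp add: K_def)
  have "v t - U n y t \<le> M / 2 ^ n * exp (K * t)" if "t \<in> {0..S}" for n y t
    using that
  proof (induction n arbitrary: y t)
    case 0
    have "v t - U 0 y t \<le> M * 1"
      using v_range[OF 0] U_ge[of t 0 y] 0 \<gamma>_pos by auto
    also have "\<dots> \<le> M * exp (K * t)"
      using \<open>0 < M\<close> 0 \<open>0 < K\<close> by (intro mult_left_mono) auto
    finally show ?case by simp
  next
    case (Suc n)
    define e where "e = M / 2 ^ n"
    have "0 \<le> e" using \<open>0 < M\<close> by (simp add: e_def)
    have step: "integral {0..t} (\<lambda>s. N (v s) s) - integral {0..t} (\<lambda>s. N (U n (y + \<sigma> * (t - s)) s) s)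
        \<le> e / 4 * exp (K * t)" for \<sigma>
    proof -
      have "integral {0..t} (\<lambda>s. N (v s) s - N (U n (y + \<sigma> * (t - s)) s) s)
          \<le> L * e / K * exp (K * t) - L * e / K"
      proof (rule integral_le_exp)
        fix s assume s: "s \<in> {0..t}"
        then have s': "s \<in> {0..S}" using Suc.prems by auto
        define u where "u = U n (y + \<sigma> * (t - s)) s"
        have u: "\<gamma> \<le> u" "v s - u \<le> e * exp (K * s)"
          using U_ge[of s] s Suc.IH[OF s'] by (auto simp: u_def e_def)
        \<comment> \<open>Only the positive excess matters. Where \<open>u\<close> is above
          \<open>v\<close> it may exceed \<open>M\<close>, outside the range of the Lipschitz bound,
          and monotonicity replaces it.\<close>
        have "N (v s) s - N u s \<le> L * e * exp (K * s)"
        proof (cases "v s \<le> u")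
          case True
          then have "N (v s) s \<le> N u s" using v_range[OF s'] s by (intro nonlin_mono) auto
          moreover have "0 \<le> L * e * exp (K * s)" using L(1) \<open>0 \<le> e\<close> by simp
          ultimately show ?thesis by linarith
        next
          case False
          then have "\<bar>N (v s) s - N u s\<bar> \<le> L * \<bar>v s - u\<bar>"
            using v_range[OF s'] u(1) s by (intro L(2)) auto
          also have "\<dots> \<le> L * (e * exp (K * s))"
            using False u(2) L(1) by (intro mult_left_mono) auto
          finally show ?thesis by (simp add: mult.assoc)
        qed
        then show "N (v s) s - N (U n (y + \<sigma> * (t - s)) s) s \<le> L * e * exp (K * s)"
          by (simp add: u_def)
      qed (use Suc.prems L(1) \<open>0 < K\<close> \<open>0 \<le> e\<close> in
            \<open>auto intro!: continuous_on_diff N_v_cont nonlin_char_continuous\<close>)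
      also have "L * e / K = e / 4" using L(1) by (simp add: K_def)
      also have "integral {0..t} (\<lambda>s. N (v s) s - N (U n (y + \<sigma> * (t - s)) s) s)
          = integral {0..t} (\<lambda>s. N (v s) s) - integral {0..t} (\<lambda>s. N (U n (y + \<sigma> * (t - s)) s) s)"
        by (intro Henstock_Kurzweil_Integration.integral_diff nonlin_char_integrable
            integrable_continuous_real N_v_cont Suc.prems) auto
      finally show ?thesis using \<open>0 \<le> e\<close> by linarith
    qed
    have "\<gamma> \<le> F 1 (y + t) + F (-1) (y - t)"
      unfolding \<gamma>_def by (intro add_mono F_ge) auto
    then have "v t - U (Suc n) y t \<le> e / 2 * exp (K * t)"
      using v_le[OF Suc.prems] step[of 1] step[of "-1"] by (simp add: U_def W_Suc)
    then show ?case by (simp add: e_def mult.commute)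
  qed
  then show ?thesis by (rule that)
qed

text \<open>A bound at time \<open>t\<close> descends to all earlier times over \<open>x\<close>. If
  \<open>t\<close> were at least \<open>T1\<close>, the Bernoulli solution, which lies below the
  iterates up to a vanishing error, would stay below \<open>M\<close> right up to its own blow-up
  time.\<close>

lemma bounded_imp_before_T1:
  assumes M: "\<And>n. U n x t \<le> M" and "0 \<le> t"
  shows "t < T1 p \<mu> \<gamma>"
proof (rule ccontr)
  assume "\<not> t < T1 p \<mu> \<gamma>"
  define T where "T = T1 p \<mu> \<gamma>"
  define q where "q = 1 / (p - 1)"
  define a where "a = 2 powr (1 - p) / \<mu>"
  define w where "w = \<gamma> powr (1 - p)"
  \<comment> \<open>The substitution \<open>z = v powr (1 - p)\<close> makes the Bernoulli equation
    linear: \<open>z' = - ((p - 1) * \<mu> * (a - z))\<close>. \<open>T1\<close> is the time at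
    which the solution starting from \<open>w\<close> reaches zero.\<close>
  define z where "z s = a - (a - w) * exp ((p - 1) * \<mu> * s)" for s
  define v where "v s = z s powr (-q)" for s
  have "T \<le> t" using \<open>\<not> t < T1 p \<mu> \<gamma>\<close> by (simp add: T_def)
  have "0 < w" using \<gamma>_pos by (simp add: w_def)
  \<comment> \<open>Makes the argument of the logarithm in \<open>T1\<close> greater than one, so
    that \<open>T\<close> is positive, and makes \<open>z\<close> strictly decreasing.\<close>
  have "w < a"
  proof -
    have "\<mu> * w \<le> 2 powr (-p) * \<gamma> powr (p - 1) * w"
      using absorb_damping[of \<gamma>] \<open>0 < w\<close> by (intro mult_right_mono) auto
    also have "\<dots> = 2 powr (-p)"
      using \<gamma>_pos by (simp add: w_def flip: powr_add)
    also have "\<dots> < 2 powr (1 - p)" by simp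
    finally show ?thesis using \<mu>_pos by (simp add: a_def field_simps)
  qed
  have expT: "exp ((p - 1) * \<mu> * T) = a / (a - w)"
  proof -
    have "(p - 1) * \<mu> * T = ln (a / (a - w))"
      using p_gt_1 \<mu>_pos by (simp add: T_def T1_def a_def w_def)
    then show ?thesis using \<open>0 < w\<close> \<open>w < a\<close> by simp
  qed
  then have zT: "z T = 0" using \<open>w < a\<close> by (simp add: z_def)
  have "1 < exp ((p - 1) * \<mu> * T)" using expT \<open>0 < w\<close> \<open>w < a\<close> by simp
  then have "0 < T" using p_gt_1 \<mu>_pos by (simp add: zero_less_mult_iff mult_less_0_iff)
  have z_anti: "z s' < z s" if "s < s'" for s s'
    using that \<open>w < a\<close> p_gt_1 \<mu>_pos by (simp add: z_def)
  have z0: "z 0 = w" by (simp add: z_def)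
  have q1: "- q * (1 - p) = 1" using p_gt_1 by (simp add: q_def field_simps)
  then have v0: "v 0 = \<gamma>"
    using \<gamma>_pos by (simp add: v_def z0 w_def powr_powr mult.commute del: mult_minus_left mult_minus_right)
  have qp: "- q * p = - q - 1" using p_gt_1 by (simp add: q_def field_simps)
  have "0 < q" using p_gt_1 by (simp add: q_def)
  have z_pos: "0 < z s" if "s < T" for s using z_anti[OF that] zT by simp
  have v_mono: "v s \<le> v s'" if "s \<le> s'" "s' < T" for s s'
    unfolding v_def using that z_anti[of s s'] z_pos[of s'] \<open>0 < q\<close>
    by (intro powr_mono2') (auto simp: le_less)
  have v_deriv: "(v has_real_derivative 2 * (2 powr (-p) * v s powr p - \<mu> / 2 * v s)) (at s)"
    if "s < T" for s
  proof -
    have "(z has_real_derivative - ((p - 1) * \<mu> * (a - z s))) (at s)"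
      unfolding z_def by (auto intro!: derivative_eq_intros simp: algebra_simps)
    then have "(v has_real_derivative (- q * z s powr (- q - 1)) * - ((p - 1) * \<mu> * (a - z s))) (at s)"
      unfolding v_def
      by (rule DERIV_chain2[where f = "\<lambda>y. y powr (-q)" and g = z and x = s,
            OF has_real_derivative_powr[OF z_pos[OF that]]])
    also have "(- q * z s powr (- q - 1)) * - ((p - 1) * \<mu> * (a - z s))
        = z s powr (- q - 1) * (\<mu> * a) - \<mu> * (z s powr (- q - 1) * z s)"
      using p_gt_1 by (simp add: q_def field_simps)
    also have "\<mu> * a = 2 * 2 powr (-p)"
      using \<mu>_pos powr_add[of 2 1 "-p"] by (simp add: a_def)
    also have "z s powr (- q - 1) * z s = v s"
      using z_pos[OF that] powr_add[of "z s" "- q - 1" 1] by (simp add: v_def)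
    also have "z s powr (- q - 1) = v s powr p"
      by (simp only: v_def powr_powr qp)
    finally show ?thesis by (simp add: algebra_simps)
  qed
  have v_le: "v s \<le> M" if s: "0 \<le> s" "s < T" for s
  proof -
    have der: "\<And>r. r \<in> {0..s} \<Longrightarrow>
        (v has_real_derivative 2 * (2 powr (-p) * v r powr p - \<mu> / 2 * v r)) (at r within {0..s})"
      by (rule has_field_derivative_at_within, rule v_deriv) (use s in auto)
    have range: "\<And>r. r \<in> {0..s} \<Longrightarrow> v r \<in> {\<gamma>..v s}"
      using v_mono[of 0] v_mono[of _ s] v0 s by auto
    obtain c K where
      cK: "\<And>n y r. r \<in> {0..s} \<Longrightarrow> v r - U n y r \<le> c / 2 ^ n * exp (K * r)"
      using ODE_comparison[OF s(1) der v0 range] by blast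
    show ?thesis
    proof (rule LIMSEQ_le_const[where X = "\<lambda>n. M + c / 2 ^ n * exp (K * s)"])
      have "(\<lambda>n. M + c / 2 ^ n * exp (K * s)) \<longlonglongrightarrow> M + 0 * exp (K * s)"
        by (intro tendsto_intros LIMSEQ_divide_realpow_zero) simp
      then show "(\<lambda>n. M + c / 2 ^ n * exp (K * s)) \<longlonglongrightarrow> M" by simp
      have "v s \<le> M + c / 2 ^ n * exp (K * s)" for n
        using cK[of s n x] U_le_of_le[OF M, of s n] s \<open>T \<le> t\<close> by simp
      then show "\<exists>k. \<forall>n\<ge>k. v s \<le> M + c / 2 ^ n * exp (K * s)" by blast
    qed
  qed
  have "0 < M" using v_le[of 0] v0 \<gamma>_pos \<open>0 < T\<close> by simp
  \<comment> \<open>The bound on \<open>v\<close> keeps \<open>z\<close> away from zero, against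
    \<open>z T = 0\<close>.\<close>
  have z_ge: "M powr (1 - p) \<le> z s" if "0 \<le> s" "s < T" for s
  proof -
    have "M powr (1 - p) \<le> v s powr (1 - p)"
      using v_le[OF that] z_pos[OF that(2)] p_gt_1 by (intro powr_mono2') (auto simp: v_def)
    also have "\<dots> = z s"
      using z_pos[OF that(2)] by (simp only: v_def powr_powr q1 powr_one)
    finally show ?thesis .
  qed
  have "(z \<longlongrightarrow> z T) (at_left T)"
    unfolding z_def by (intro tendsto_intros)
  moreover have "\<forall>\<^sub>F s in at_left T. M powr (1 - p) \<le> z s"
    using eventually_at_left_real[OF \<open>0 < T\<close>] by eventually_elim (auto intro: z_ge)
  ultimately have "M powr (1 - p) \<le> z T" by (rule tendsto_lowerbound) simp
  with zT \<open>0 < M\<close> show False by simp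
qed

subsection \<open>Blow-up rate\<close>

text \<open>For \<open>h = rate_below * M powr (1 - p)\<close> the smallness condition of
  \<open>U_extend\<close> holds with equality, so this is the longest step it permits.\<close>

definition rate_below :: real where "rate_below = \<epsilon> / (1 + \<epsilon>) * 3 powr (-p)"

text \<open>Each component grows at least at rate \<open>N / 2\<close>, and \<open>N\<close> is at
  least half of \<open>2 powr (-p) * u powr p\<close>; the factor \<open>p - 1\<close> comes from
  differentiating \<open>u powr (1 - p)\<close>.\<close>

definition rate_above :: real where "rate_above = (p - 1) * (2 powr (-p) / 2)"

lemma extension_time:
  assumes M: "\<And>n. U n x t \<le> M" and "0 \<le> t"
  shows "U n x (t + rate_below * M powr (1 - p)) \<le> 6 * M"
proof (rule U_extend[OF assms])
  have "0 < M" using M[of 0] U_ge[OF \<open>0 \<le> t\<close>, of 0 x] \<gamma>_pos by linarith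
  then show "0 < rate_below * M powr (1 - p)"
    using \<epsilon>_pos by (simp add: rate_below_def)
  define h where "h = rate_below * M powr (1 - p)"
  have "M powr (1 - p) * M powr (p - 1) = 1" "3 powr (-p) * 3 powr p = (1 :: real)"
    using \<open>0 < M\<close> by (simp_all flip: powr_add)
  moreover have "h + h / \<epsilon> = 3 powr (-p) * M powr (1 - p)"
    using \<epsilon>_pos by (simp add: h_def rate_below_def divide_simps) (simp add: algebra_simps)
  ultimately show "(h + h / \<epsilon>) * 3 powr p * M powr (p - 1) \<le> 1"
    by (simp add: mult_ac)
qed

lemma UL_deriv_t:
  assumes M: "\<And>n. U n x t1 \<le> M" and "0 < t" "t < t1"
  obtains D where "((\<lambda>t. UL x t) has_real_derivative D) (at t)" "2 powr (-p) / 2 * UL x t powr p \<le> D"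
proof -
  obtain D1 where D1: "((\<lambda>t. WL 1 x t) has_real_derivative D1) (at t)" "N (UL x t) t / 2 \<le> D1"
    by (rule WL_deriv_t[OF M, of 1 t]) (use assms in auto)
  obtain D2 where D2: "((\<lambda>t. WL (-1) x t) has_real_derivative D2) (at t)" "N (UL x t) t / 2 \<le> D2"
    by (rule WL_deriv_t[OF M, of "-1" t]) (use assms in auto)
  have "\<gamma> \<le> UL x t" by (rule UL_ge[OF U_le_of_le[OF M]]) (use assms in auto)
  with nonlin_lower[of "UL x t" t] D1(2) D2(2) assms
  have "2 powr (-p) / 2 * UL x t powr p \<le> D1 + D2" by simp
  then show ?thesis
    using DERIV_add[OF D1(1) D2(1)] that[of "D1 + D2"] by (simp add: UL_def)
qed

text \<open>The power \<open>1 - p\<close> turns \<open>u' \<ge> c * u powr p\<close> into a linear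
  rate of decrease, and the quantity is still nonnegative at \<open>t'\<close>.\<close>

lemma UL_decay:
  assumes M: "\<And>n. U n x t1 \<le> M" and "0 < t" "t \<le> t'" "t' < t1"
  shows "rate_above * (t' - t) \<le> UL x t powr (1 - p)"
proof -
  have UL_pos: "0 < UL x s" if "0 \<le> s" "s \<le> t1" for s
    using UL_ge[OF U_le_of_le[OF M that] that(1)] \<gamma>_pos by linarith
  have "UL x t' powr (1 - p) + rate_above * t' \<le> UL x t powr (1 - p) + rate_above * t"
  proof (rule DERIV_nonpos_imp_nonincreasing[OF assms(3)])
    fix s assume s: "t \<le> s" "s \<le> t'"
    obtain D where D: "((\<lambda>t. UL x t) has_real_derivative D) (at s)"
      "2 powr (-p) / 2 * UL x s powr p \<le> D"
      by (rule UL_deriv_t[OF M, of s]) (use assms s in auto)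
    have pos: "0 < UL x s" using UL_pos[of s] assms s by simp
    have "((\<lambda>s. UL x s powr (1 - p) + rate_above * s) has_real_derivative
        (1 - p) * UL x s powr (1 - p - 1) * D + rate_above * 1) (at s)"
      by (intro DERIV_add DERIV_cmult DERIV_ident
          DERIV_chain2[OF has_real_derivative_powr[OF pos, of "1 - p"] D(1)])
    moreover have "(1 - p) * UL x s powr (1 - p - 1) * D + rate_above * 1 \<le> 0"
    proof -
      have "UL x s powr (-p) * (2 powr (-p) / 2 * UL x s powr p) \<le> UL x s powr (-p) * D"
        using D(2) by (intro mult_left_mono) auto
      moreover have "UL x s powr (-p) * UL x s powr p = 1"
        using pos by (simp flip: powr_add)
      ultimately have "2 powr (-p) / 2 \<le> UL x s powr (-p) * D"
        by (simp add: mult_ac)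
      then have "(p - 1) * (2 powr (-p) / 2) \<le> (p - 1) * (UL x s powr (-p) * D)"
        using p_gt_1 by (intro mult_left_mono) auto
      then show ?thesis by (simp add: rate_above_def algebra_simps)
    qed
    ultimately show "\<exists>y. ((\<lambda>s. UL x s powr (1 - p) + rate_above * s) has_real_derivative y) (at s) \<and> y \<le> 0"
      by blast
  qed
  moreover have "0 \<le> UL x t' powr (1 - p)" by simp
  ultimately show ?thesis by (simp only: right_diff_distrib)
qed

text \<open>\<open>\<Phi>\<close> and \<open>\<Psi>\<close> are kept abstract because the iterates of the original data agree with those of
  data extended to the whole line only below time \<open>Ts\<close>.\<close>

lemma blowup_estimates:
  fixes \<Phi> \<Psi> :: "real \<Rightarrow> ereal"
  assumes \<Phi>: "\<And>s. 0 < s \<Longrightarrow> s < Ts \<Longrightarrow> \<Phi> s = (SUP n. ereal (W 1 n x s))"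
    and \<Psi>: "\<And>s. 0 < s \<Longrightarrow> s < Ts \<Longrightarrow> \<Psi> s = (SUP n. ereal (W (-1) n x s))"
    and "0 < Ts" "T1 p \<mu> \<gamma> < Ts"
  defines "Tx \<equiv> Sup {s. 0 < s \<and> s < Ts \<and> \<Phi> s + \<Psi> s < \<infinity>}"
  assumes "0 < t" "t < Tx"
  defines "u \<equiv> real_of_ereal (\<Phi> t) + real_of_ereal (\<Psi> t)"
  shows "\<Phi> t < \<infinity>" "\<Psi> t < \<infinity>" "0 < u"
    "rate_below * u powr (1 - p) \<le> Tx - t" "rate_above * (Tx - t) \<le> u powr (1 - p)"
    "\<exists>D. ((\<lambda>s. real_of_ereal (\<Phi> s)) has_real_derivative D) (at t)
       \<and> 2 powr (-p) / 4 * u powr p \<le> D \<and> D \<le> (1 + \<epsilon>) / \<epsilon> * 2 powr (-p) * u powr p"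
    "\<exists>D. ((\<lambda>s. real_of_ereal (\<Psi> s)) has_real_derivative D) (at t)
       \<and> 2 powr (-p) / 4 * u powr p \<le> D \<and> D \<le> (1 + \<epsilon>) / \<epsilon> * 2 powr (-p) * u powr p"
proof -
  define X where "X = {s. 0 < s \<and> s < Ts \<and> (\<exists>M. \<forall>n. U n x s \<le> M)}"
  have finite_iff: "\<Phi> s < \<infinity> \<and> \<Psi> s < \<infinity> \<longleftrightarrow> (\<exists>M. \<forall>n. U n x s \<le> M)" if s: "0 < s" "s < Ts" for s
  proof
    assume "\<Phi> s < \<infinity> \<and> \<Psi> s < \<infinity>"
    then obtain M1 M2 where "\<And>n. W 1 n x s \<le> M1" "\<And>n. W (-1) n x s \<le> M2"
      unfolding \<Phi>[OF s] \<Psi>[OF s] SUP_ereal_less_PInf_iff by blast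
    then have "U n x s \<le> M1 + M2" for n by (simp add: U_def add_mono)
    then show "\<exists>M. \<forall>n. U n x s \<le> M" by blast
  next
    assume "\<exists>M. \<forall>n. U n x s \<le> M"
    then obtain M where "\<And>n. U n x s \<le> M" by blast
    then have "W \<sigma> n x s \<le> M" if "\<bar>\<sigma>\<bar> = 1" for \<sigma> n
      using W_le_U[OF that, of s n x] \<open>0 < s\<close> by (meson less_imp_le order_trans)
    from this[of 1] this[of "-1"] show "\<Phi> s < \<infinity> \<and> \<Psi> s < \<infinity>"
      unfolding \<Phi>[OF s] \<Psi>[OF s] SUP_ereal_less_PInf_iff by auto
  qed
  then have Tx: "Tx = Sup X"
  proof -
    have "\<Phi> s + \<Psi> s < \<infinity> \<longleftrightarrow> \<Phi> s < \<infinity> \<and> \<Psi> s < \<infinity>" for s by simp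
    with finite_iff show ?thesis
      unfolding Tx_def X_def by (intro arg_cong[where f = Sup] Collect_cong) blast
  qed
  have X_le: "s \<le> T1 p \<mu> \<gamma>" if "s \<in> X" for s
    using bounded_imp_before_T1[of x s] that by (force simp: X_def)
  then have bdd: "bdd_above X" by (rule bdd_aboveI)
  \<comment> \<open>The supremum of an empty set would be unspecified. The iterates at time 0 are
    bounded by the data, and one extension step from there supplies an admissible positive
    time.\<close>
  have "\<exists>s. s \<in> X"
  proof -
    define M where "M = F 1 x + F (-1) x"
    have W0: "W \<sigma> n x 0 \<le> F \<sigma> x" if "\<bar>\<sigma>\<bar> = 1" for \<sigma> n
      using F_ge[OF that, of x] by (cases n) (simp_all add: W_0[OF that] W_Suc[OF that])
    then have M: "U n x 0 \<le> M" for n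
      unfolding U_def M_def by (intro add_mono) auto
    define h where "h = rate_below * M powr (1 - p)"
    have "0 < M" using M[of 0] U_ge[of 0 0 x] \<gamma>_pos by linarith
    then have "0 < h" using \<epsilon>_pos by (simp add: h_def rate_below_def)
    have bd: "U n x h \<le> 6 * M" for n
      using extension_time[OF M, of n] by (simp add: h_def)
    have "U n x (min h (Ts / 2)) \<le> 6 * M" for n
      by (rule U_le_of_le[OF bd]) (use \<open>0 < h\<close> \<open>0 < Ts\<close> in auto)
    then show ?thesis
      using \<open>0 < h\<close> \<open>0 < Ts\<close> by (intro exI[of _ "min h (Ts / 2)"]) (auto simp: X_def)
  qed
  then have "X \<noteq> {}" by blast
  \<comment> \<open>Together with \<open>T1 < Ts\<close> this makes \<open>Tx\<close> a genuine
    blow-up time and not the cutoff in its definition.\<close>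
  have Tx_le: "Tx \<le> T1 p \<mu> \<gamma>" unfolding Tx using \<open>X \<noteq> {}\<close> X_le by (rule cSup_least)
  have later: "\<exists>s1 M. s < s1 \<and> (\<forall>n. U n x s1 \<le> M)" if "s < Tx" for s
    using less_cSupD[OF \<open>X \<noteq> {}\<close>] that unfolding Tx X_def by fast
  obtain t1 M where t1: "t < t1" and M: "\<And>n. U n x t1 \<le> M"
    using later[OF \<open>t < Tx\<close>] by blast
  have "t < Ts" using \<open>t < Tx\<close> Tx_le assms(4) by linarith
  have M': "U n x t \<le> M" for n using U_le_of_le[OF M, of t n] t1 \<open>0 < t\<close> by simp
  show "\<Phi> t < \<infinity>" "\<Psi> t < \<infinity>"
    using finite_iff[OF \<open>0 < t\<close> \<open>t < Ts\<close>] M' by blast+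
  have real_eq: "real_of_ereal (\<Phi> s) = WL 1 x s" "real_of_ereal (\<Psi> s) = WL (-1) x s"
    if s: "s \<in> {0<..<Tx}" for s
  proof -
    have s': "0 < s" "s < Ts" using s Tx_le assms(4) by auto
    obtain s1 M1 where s1: "s < s1" "\<And>n. U n x s1 \<le> M1" using later[of s] s by auto
    have "(SUP n. ereal (W \<sigma> n x s)) = ereal (WL \<sigma> x s)" if "\<bar>\<sigma>\<bar> = 1" for \<sigma>
      using s' s1 that by (intro SUP_ereal_eq_limit W_incseq W_tendsto[OF U_le_of_le[OF s1(2)]]) auto
    from this[of 1] this[of "-1"]
    show "real_of_ereal (\<Phi> s) = WL 1 x s" "real_of_ereal (\<Psi> s) = WL (-1) x s"
      using \<Phi>[OF s'] \<Psi>[OF s'] by simp_all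
  qed
  have u: "u = UL x t"
    unfolding u_def UL_def using real_eq[of t] \<open>0 < t\<close> \<open>t < Tx\<close> by simp
  have "\<gamma> \<le> u" unfolding u by (rule UL_ge[OF M']) (use \<open>0 < t\<close> in auto)
  then show "0 < u" using \<gamma>_pos by linarith
  have U_le_u: "U n x t \<le> u" for n
    unfolding u by (rule U_le_UL[OF M']) (use \<open>0 < t\<close> in auto)
  show "rate_below * u powr (1 - p) \<le> Tx - t"
  proof -
    define h where "h = rate_below * u powr (1 - p)"
    have "0 < h" using \<open>0 < u\<close> \<epsilon>_pos by (simp add: h_def rate_below_def)
    have bd: "\<And>n. U n x (t + h) \<le> 6 * u"
      using extension_time[OF U_le_u] \<open>0 < t\<close> by (simp add: h_def)
    \<comment> \<open>Boundedness at \<open>t + h\<close> by itself forces that time below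
      \<open>T1\<close>, so the extension cannot overshoot \<open>Ts\<close>.\<close>
    have "t + h < T1 p \<mu> \<gamma>"
      by (rule bounded_imp_before_T1[OF bd]) (use \<open>0 < t\<close> \<open>0 < h\<close> in auto)
    then have "t + h \<in> X" using bd assms(4) \<open>0 < t\<close> \<open>0 < h\<close> by (auto simp: X_def)
    then have "t + h \<le> Tx" unfolding Tx using bdd by (rule cSup_upper)
    then show ?thesis by (simp add: h_def)
  qed
  show "rate_above * (Tx - t) \<le> u powr (1 - p)"
  proof (rule ccontr)
    define Y where "Y = u powr (1 - p)"
    have "0 < Y" using \<open>0 < u\<close> by (simp add: Y_def)
    have ra: "0 < rate_above" using p_gt_1 by (simp add: rate_above_def)
    assume "\<not> ?thesis"
    then have "t + Y / rate_above < Tx" using ra by (simp add: Y_def field_simps)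
    \<comment> \<open>\<open>UL_decay\<close> needs boundedness beyond its second time, hence a
      \<open>t'\<close> strictly before \<open>Tx\<close> that still violates the estimate.\<close>
    then obtain t' where t': "t + Y / rate_above < t'" and "t' < Tx" using dense by blast
    have "0 < Y / rate_above" using \<open>0 < Y\<close> ra by simp
    then have "t \<le> t'" using t' by linarith
    obtain s1 M1 where s1: "t' < s1" "\<And>n. U n x s1 \<le> M1" using later[OF \<open>t' < Tx\<close>] by blast
    have "rate_above * (t' - t) \<le> Y"
      unfolding Y_def u by (rule UL_decay[OF s1(2)]) (use \<open>0 < t\<close> \<open>t \<le> t'\<close> s1(1) in auto)
    moreover have "Y < rate_above * (t' - t)" using t' ra by (simp add: field_simps)
    ultimately show False by simp
  qed
  have deriv: "\<exists>D. (\<Theta> has_real_derivative D) (at t)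
       \<and> 2 powr (-p) / 4 * u powr p \<le> D \<and> D \<le> (1 + \<epsilon>) / \<epsilon> * 2 powr (-p) * u powr p"
    if \<Theta>: "\<And>s. s \<in> {0<..<Tx} \<Longrightarrow> \<Theta> s = WL \<sigma> x s" and \<sigma>: "\<bar>\<sigma>\<bar> = 1" for \<Theta> \<sigma>
  proof -
    obtain D where D: "((\<lambda>t. WL \<sigma> x t) has_real_derivative D) (at t)"
      "N u t / 2 \<le> D" "D \<le> (1 + \<epsilon>) / \<epsilon> * N u t"
      unfolding u by (rule WL_deriv_t[OF M \<sigma> \<open>0 < t\<close> t1])
    have "(\<Theta> has_real_derivative D) (at t)"
      by (rule has_field_derivative_transform_within_open[OF D(1), of "{0<..<Tx}"])
         (use \<Theta> \<open>0 < t\<close> \<open>t < Tx\<close> in auto)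
    moreover have "2 powr (-p) / 4 * u powr p \<le> D"
      using nonlin_lower[OF \<open>\<gamma> \<le> u\<close>, of t] D(2) \<open>0 < t\<close> by simp
    moreover have "(1 + \<epsilon>) / \<epsilon> * N u t \<le> (1 + \<epsilon>) / \<epsilon> * (2 powr (-p) * u powr p)"
      using nonlin_upper[OF \<open>\<gamma> \<le> u\<close>, of t] \<open>0 < t\<close> \<epsilon>_pos by (intro mult_left_mono) auto
    ultimately show ?thesis using D(3) by (intro exI[of _ D]) (auto simp: mult.assoc)
  qed
  show "\<exists>D. ((\<lambda>s. real_of_ereal (\<Phi> s)) has_real_derivative D) (at t)
       \<and> 2 powr (-p) / 4 * u powr p \<le> D \<and> D \<le> (1 + \<epsilon>) / \<epsilon> * 2 powr (-p) * u powr p"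
    by (rule deriv[of _ 1]) (use real_eq in auto)
  show "\<exists>D. ((\<lambda>s. real_of_ereal (\<Psi> s)) has_real_derivative D) (at t)
       \<and> 2 powr (-p) / 4 * u powr p \<le> D \<and> D \<le> (1 + \<epsilon>) / \<epsilon> * 2 powr (-p) * u powr p"
    by (rule deriv[of _ "-1"]) (use real_eq in auto)
qed

end

section \<open>Localisation to the domain of dependence\<close>

text \<open>Composing the data with \<open>\<theta>\<close> extends them to the line: all values are
  taken inside the open interval where the hypotheses hold, slopes do not grow, and nothing changes
  up to distance \<open>a\<close>.\<close>

lemma soft_clamp:
  fixes a b :: real
  assumes "0 \<le> a" "a < b"
  obtains \<theta> \<theta>' :: "real \<Rightarrow> real" where
    "\<And>y. (\<theta> has_real_derivative \<theta>' y) (at y)" "continuous_on UNIV \<theta>'"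
    "\<And>y. \<bar>\<theta> y\<bar> < b" "\<And>y. \<bar>\<theta>' y\<bar> \<le> 1" "\<And>y. \<bar>y\<bar> \<le> a \<Longrightarrow> \<theta> y = y"
proof -
  define d where "d = b - a"
  have "0 < d" using assms by (simp add: d_def)
  \<comment> \<open>For \<open>z \<ge> 0\<close> this equals \<open>z^2 / (z + d)\<close>. It
    vanishes to second order at 0, so the clamp is continuously differentiable, and
    \<open>z - r z = d * z / (z + d)\<close> saturates strictly below
    \<open>d = b - a\<close>.\<close>
  define r where "r z = max 0 z - d + d\<^sup>2 / (max 0 z + d)" for z :: real
  define r' where "r' z = 1 - d\<^sup>2 / (max 0 z + d)\<^sup>2" for z :: real
  have r_neg: "r z = 0" "r' z = 0" if "z \<le> 0" for z
    using that \<open>0 < d\<close> by (simp_all add: r_def r'_def power2_eq_square)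
  have r_pos: "r z = z\<^sup>2 / (z + d)" if "0 \<le> z" for z
    using that \<open>0 < d\<close> by (simp add: r_def field_simps power2_eq_square)
  have r_deriv: "(r has_real_derivative r' z) (at z)" for z
  proof -
    consider "z < 0" | "z = 0" | "0 < z" by linarith
    then show ?thesis
    proof cases
      case 1
      then have "((\<lambda>z. 0) has_real_derivative r' z) (at z)" using r_neg by simp
      then show ?thesis
        by (rule has_field_derivative_transform_within_open[of _ _ _ "{..<0}"]) (use 1 r_neg in auto)
    next
      case 2
      have bound: "norm (r h / h) \<le> \<bar>h\<bar> / d" for h
      proof (cases "0 < h")
        case True
        then have "r h / h = h / (h + d)" using r_pos[of h] by (simp add: power2_eq_square)
        then show ?thesis using True \<open>0 < d\<close> by (simp add: frac_le)
      qed (use r_neg[of h] \<open>0 < d\<close> in \<open>simp add: divide_le_0_iff\<close>)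
      have "((\<lambda>h. \<bar>h\<bar> / d) \<longlongrightarrow> \<bar>0\<bar> / d) (at 0)"
        by (intro tendsto_divide tendsto_rabs tendsto_ident_at tendsto_const) (use \<open>0 < d\<close> in auto)
      then have lim: "((\<lambda>h. \<bar>h\<bar> / d) \<longlongrightarrow> 0) (at 0)" by simp
      have "((\<lambda>h. r h / h) \<longlongrightarrow> 0) (at 0)"
        by (rule Lim_null_comparison[OF _ lim], rule always_eventually, rule allI, rule bound)
      then show ?thesis using 2 r_neg[of 0] by (simp add: DERIV_def)
    next
      case 3
      have "((\<lambda>z. z - d + d\<^sup>2 / (z + d)) has_real_derivative 1 - d\<^sup>2 / (z + d)\<^sup>2) (at z)"
        using 3 \<open>0 < d\<close> by (auto intro!: derivative_eq_intros simp: power2_eq_square)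
      then have "((\<lambda>z. z - d + d\<^sup>2 / (z + d)) has_real_derivative r' z) (at z)"
        using 3 by (simp add: r'_def)
      then show ?thesis
        by (rule has_field_derivative_transform_within_open[of _ _ _ "{0<..}"]) (use 3 in \<open>auto simp: r_def\<close>)
    qed
  qed
  have r'_range: "0 \<le> r' z" "r' z \<le> 1" for z
  proof -
    have "d\<^sup>2 \<le> (max 0 z + d)\<^sup>2" using \<open>0 < d\<close> by (intro power_mono) auto
    then show "0 \<le> r' z" "r' z \<le> 1" using \<open>0 < d\<close> by (simp_all add: r'_def divide_le_eq)
  qed
  have r_range: "z - d < r z" "r z \<le> z" if "0 \<le> z" for z
    using that \<open>0 < d\<close> by (simp_all add: r_pos field_simps power2_eq_square)
  define \<theta> where "\<theta> y = y - r (y - a) + r (- y - a)" for y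
  define \<theta>' where "\<theta>' y = 1 - r' (y - a) - r' (- y - a)" for y
  show ?thesis
  proof (rule that[of \<theta> \<theta>'])
    fix y
    have "((\<lambda>y. r (y - a)) has_real_derivative r' (y - a) * 1) (at y)"
      by (rule DERIV_chain2[where f = r, OF r_deriv]) (auto intro!: derivative_eq_intros)
    moreover have "((\<lambda>y. r (- y - a)) has_real_derivative r' (- y - a) * -1) (at y)"
      by (rule DERIV_chain2[where f = r, OF r_deriv]) (auto intro!: derivative_eq_intros)
    ultimately have "((\<lambda>y. y - r (y - a) + r (- y - a)) has_real_derivative
        1 - r' (y - a) * 1 + r' (- y - a) * -1) (at y)"
      by (intro DERIV_add DERIV_diff DERIV_ident)
    then show "(\<theta> has_real_derivative \<theta>' y) (at y)"
      unfolding \<theta>_def \<theta>'_def by simp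
    show "\<theta> y = y" if "\<bar>y\<bar> \<le> a"
      using that r_neg[of "y - a"] r_neg[of "- y - a"] by (simp add: \<theta>_def)
    consider "\<bar>y\<bar> \<le> a" | "a < y" | "y < - a" by linarith
    then show "\<bar>\<theta> y\<bar> < b"
    proof cases
      case 1
      then show ?thesis using r_neg[of "y - a"] r_neg[of "- y - a"] assms by (simp add: \<theta>_def)
    next
      case 2
      then show ?thesis
        using r_range[of "y - a"] r_neg[of "- y - a"] assms by (simp add: \<theta>_def d_def)
    next
      case 3
      then show ?thesis
        using r_range[of "- y - a"] r_neg[of "y - a"] assms by (simp add: \<theta>_def d_def)
    qed
    show "\<bar>\<theta>' y\<bar> \<le> 1"
      using r'_range[of "y - a"] r'_range[of "- y - a"] r_neg[of "y - a"] r_neg[of "- y - a"] assms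
      by (cases "0 \<le> y") (auto simp: \<theta>'_def)
  next
    have "max 0 z + d \<noteq> 0" for z :: real using \<open>0 < d\<close> by (simp add: max_def)
    then show "continuous_on UNIV \<theta>'"
      unfolding \<theta>'_def r'_def by (intro continuous_intros) auto
  qed
qed

lemma Ck_on_Icc_derivE:
  assumes "Ck_on k {-L..L} f" "2 \<le> k"
  obtains f' where "continuous_on {-L<..<L} f'"
    "\<And>x. \<bar>x\<bar> < L \<Longrightarrow> (f has_real_derivative f' x) (at x)" "\<And>x. \<bar>x\<bar> < L \<Longrightarrow> deriv f x = f' x"
proof -
  obtain D where D0: "D 0 = f" and
    D: "\<And>j x. j < k \<Longrightarrow> x \<in> {-L..L} \<Longrightarrow> (D j has_real_derivative D (Suc j) x) (at x within {-L..L})"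
    using assms(1) unfolding Ck_on_def by blast
  have "continuous_on {-L..L} (D 1)"
    by (rule DERIV_continuous_on[OF D]) (use assms(2) in auto)
  then have cont: "continuous_on {-L<..<L} (D 1)"
    by (rule continuous_on_subset) auto
  have der: "(f has_real_derivative D 1 x) (at x)" if "\<bar>x\<bar> < L" for x
  proof -
    have "-L < x" "x < L" using that by auto
    then show ?thesis
      using D[of 0 x] assms(2) D0 at_within_Icc_at[of "-L" x L] by auto
  qed
  from cont der DERIV_imp_deriv[OF der] show ?thesis by (rule that)
qed

text \<open>Finite propagation speed: on the backward characteristics from \<open>(x, t)\<close> the
  quantity \<open>|y| + s\<close> never exceeds \<open>|x| + t\<close>.\<close>

lemma iter_cong:
  assumes f: "\<And>y. \<bar>y\<bar> \<le> L \<Longrightarrow> f y = f2 y" and g: "\<And>y. \<bar>y\<bar> \<le> L \<Longrightarrow> g y = g2 y"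
  shows "0 \<le> t \<Longrightarrow> \<bar>x\<bar> + t \<le> L \<Longrightarrow>
      phi_n p \<mu> f g \<gamma>1 \<gamma>2 n x t = phi_n p \<mu> f2 g2 \<gamma>1 \<gamma>2 n x t \<and>
      psi_n p \<mu> f g \<gamma>1 \<gamma>2 n x t = psi_n p \<mu> f2 g2 \<gamma>1 \<gamma>2 n x t"
proof (induction n arbitrary: x t)
  case 0
  then show ?case by (simp add: phi_n_def psi_n_def)
next
  case (Suc n)
  have eq: "phi_n p \<mu> f g \<gamma>1 \<gamma>2 n y s = phi_n p \<mu> f2 g2 \<gamma>1 \<gamma>2 n y s"
    "psi_n p \<mu> f g \<gamma>1 \<gamma>2 n y s = psi_n p \<mu> f2 g2 \<gamma>1 \<gamma>2 n y s"
    if "s \<in> {0..t}" "y = x + t - s \<or> y = x - t + s" for y s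
  proof -
    have "0 \<le> s" "\<bar>y\<bar> + s \<le> L" using that Suc.prems by auto
    then show "phi_n p \<mu> f g \<gamma>1 \<gamma>2 n y s = phi_n p \<mu> f2 g2 \<gamma>1 \<gamma>2 n y s"
      "psi_n p \<mu> f g \<gamma>1 \<gamma>2 n y s = psi_n p \<mu> f2 g2 \<gamma>1 \<gamma>2 n y s"
      using Suc.IH by blast+
  qed
  have "f (x + t) = f2 (x + t)" "g (x - t) = g2 (x - t)"
    using Suc.prems by (auto intro!: f g)
  moreover have "phi_n p \<mu> f g \<gamma>1 \<gamma>2 (Suc n) x t = f (x + t) + integral {0..t} (\<lambda>s. nonlin p \<mu>
        (phi_n p \<mu> f g \<gamma>1 \<gamma>2 n (x + t - s) s + psi_n p \<mu> f g \<gamma>1 \<gamma>2 n (x + t - s) s) s)"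
    "psi_n p \<mu> f g \<gamma>1 \<gamma>2 (Suc n) x t = g (x - t) + integral {0..t} (\<lambda>s. nonlin p \<mu>
        (phi_n p \<mu> f g \<gamma>1 \<gamma>2 n (x - t + s) s + psi_n p \<mu> f g \<gamma>1 \<gamma>2 n (x - t + s) s) s)" for f g
    by (simp_all add: phi_n_def psi_n_def Let_def)
  ultimately show ?case
    by (auto intro!: Henstock_Kurzweil_Integration.integral_cong simp: eq)
qed

section \<open>Choice of the constants and reduction to extended data\<close>

theorem theorem3p2:
  fixes p \<epsilon>0 :: real
  assumes "p > 1" and "\<epsilon>0 > 0"
  shows "\<exists>C1>0. \<exists>C2>0. \<forall>\<mu> Rstar Tstar \<gamma>1 \<gamma>2 (f :: real \<Rightarrow> real) (g :: real \<Rightarrow> real).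
    (\<mu> > 0 \<and> p < 1 + 2 / \<mu> \<and> Rstar > 0 \<and> Tstar > 0 \<and> \<gamma>1 > 0 \<and> \<gamma>2 > 0 \<and>
     \<gamma>1 + \<gamma>2 > max 1 ((\<mu> * p * 2 powr p) powr (1 / (p - 1))) \<and>
     T1 p \<mu> (\<gamma>1 + \<gamma>2) < Tstar \<and>
     (\<forall>x. \<bar>x\<bar> < Rstar + Tstar \<longrightarrow> f x \<ge> \<gamma>1 \<and> g x \<ge> \<gamma>2) \<and>
     Ck_on 4 {-(Rstar + Tstar)..Rstar + Tstar} f \<and>
     Ck_on 4 {-(Rstar + Tstar)..Rstar + Tstar} g \<and>
     (\<forall>x. \<bar>x\<bar> < Rstar + Tstar \<longrightarrow>
        2 powr (-p) * (\<gamma>1 + \<gamma>2) powr p - \<mu> / 2 * (\<gamma>1 + \<gamma>2)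
          \<ge> (2 + \<epsilon>0) * (\<bar>deriv f x\<bar> + \<bar>deriv g x\<bar>)))
    \<longrightarrow>
    (\<forall>(x, t) \<in> Omega p \<mu> f g \<gamma>1 \<gamma>2 Rstar Tstar.
       let \<Phi> = phi p \<mu> f g \<gamma>1 \<gamma>2; \<Psi> = psi p \<mu> f g \<gamma>1 \<gamma>2;
           S = \<Phi> x t + \<Psi> x t; Tx = blowup_time p \<mu> f g \<gamma>1 \<gamma>2 Tstar x;
           q = 1 / (p - 1)
       in phi_sup p \<mu> f g \<gamma>1 \<gamma>2 x t < \<infinity> \<and> psi_sup p \<mu> f g \<gamma>1 \<gamma>2 x t < \<infinity> \<and>
          (\<exists>d\<Phi> d\<Psi>. ((\<lambda>s. \<Phi> x s) has_real_derivative d\<Phi>) (at t) \<and>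
                    ((\<lambda>s. \<Psi> x s) has_real_derivative d\<Psi>) (at t) \<and>
             C1 * S powr p \<le> d\<Phi> \<and> d\<Phi> \<le> C2 * S powr p \<and>
             C1 * (Tx - t) powr (-q - 1) \<le> d\<Phi> \<and> d\<Phi> \<le> C2 * (Tx - t) powr (-q - 1) \<and>
             C1 * S powr p \<le> d\<Psi> \<and> d\<Psi> \<le> C2 * S powr p \<and>
             C1 * (Tx - t) powr (-q - 1) \<le> d\<Psi> \<and> d\<Psi> \<le> C2 * (Tx - t) powr (-q - 1) \<and>
             C1 * (Tx - t) powr (-q) \<le> S \<and> S \<le> C2 * (Tx - t) powr (-q)))"
proof -
  define q where "q = 1 / (p - 1)"
  \<comment> \<open>\<open>cl\<close> and \<open>cu\<close> combine the derivative bounds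
    \<open>N / 2\<close> and \<open>(1 + \<epsilon>0) / \<epsilon>0 * N\<close> with the comparison
    of \<open>N\<close> and \<open>u powr p\<close>.\<close>
  define cl where "cl = 2 powr (-p) / 4"
  define cu where "cu = (1 + \<epsilon>0) / \<epsilon>0 * 2 powr (-p)"
  define d where "d = \<epsilon>0 / (1 + \<epsilon>0) * 3 powr (-p)"
  define b where "b = (p - 1) * (2 powr (-p) / 2)"
  \<comment> \<open>\<open>d\<close> and \<open>b\<close> are \<open>rate_below\<close> and
    \<open>rate_above\<close>. Solving the bounds on \<open>u powr (1 - p)\<close> for
    \<open>u\<close> yields the factors \<open>d powr q\<close> and \<open>b powr (-q)\<close>;
    raising to the power \<open>p\<close> turns the exponent \<open>q\<close> into
    \<open>q * p = q + 1\<close>.\<close>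
  define C1 where "C1 = min cl (min (cl * d powr (q + 1)) (d powr q))"
  define C2 where "C2 = max cu (max (cu * b powr (-q - 1)) (b powr (-q)))"
  have pos: "0 < cl" "0 < cu" "0 < d" "0 < b" "0 < q"
    using assms by (simp_all add: cl_def cu_def d_def b_def q_def)
  have q: "- q * (1 - p) = 1" "- q * p = - q - 1" "- q * p = - (q + 1)"
    using assms by (simp_all add: q_def field_simps)
  have "0 < C1" "0 < C2" using pos by (auto simp: C1_def C2_def)
  show ?thesis
  proof (rule exI[of _ C1], rule conjI[OF \<open>0 < C1\<close>], rule exI[of _ C2], rule conjI[OF \<open>0 < C2\<close>],
      intro allI impI, clarify)
    fix \<mu> Rs Ts \<gamma>1 \<gamma>2 :: real and f g :: "real \<Rightarrow> real" and x t :: real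
    assume h: "0 < \<mu>" "p < 1 + 2 / \<mu>" "0 < Rs" "0 < Ts" "0 < \<gamma>1" "0 < \<gamma>2"
      "max 1 ((\<mu> * p * 2 powr p) powr (1 / (p - 1))) < \<gamma>1 + \<gamma>2" "T1 p \<mu> (\<gamma>1 + \<gamma>2) < Ts"
      "\<forall>x. \<bar>x\<bar> < Rs + Ts \<longrightarrow> \<gamma>1 \<le> f x \<and> \<gamma>2 \<le> g x"
      "Ck_on 4 {-(Rs + Ts)..Rs + Ts} f" "Ck_on 4 {-(Rs + Ts)..Rs + Ts} g"
      "\<forall>x. \<bar>x\<bar> < Rs + Ts \<longrightarrow> (2 + \<epsilon>0) * (\<bar>deriv f x\<bar> + \<bar>deriv g x\<bar>)
         \<le> 2 powr (-p) * (\<gamma>1 + \<gamma>2) powr p - \<mu> / 2 * (\<gamma>1 + \<gamma>2)"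
      and \<Omega>: "(x, t) \<in> Omega p \<mu> f g \<gamma>1 \<gamma>2 Rs Ts"
    define L where "L = Rs + Ts"
    \<comment> \<open>The extension is chosen anew for each \<open>x\<close>:
      \<open>|x| < Rs\<close> leaves a gap between \<open>L'\<close> and \<open>L\<close> in which
      the clamp can bend. This suffices because the claims concern only the vertical line over
      \<open>x\<close>, and the constants do not depend on the gap.\<close>
    define L' where "L' = \<bar>x\<bar> + Ts"
    have xt: "\<bar>x\<bar> < Rs" "0 < t" "t < blowup_time p \<mu> f g \<gamma>1 \<gamma>2 Ts x"
      using \<Omega> by (auto simp: Omega_def)
    have LL: "0 \<le> L'" "L' < L" using xt h(4) by (simp_all add: L_def L'_def)
    obtain \<theta> \<theta>' where \<theta>: "\<And>y. (\<theta> has_real_derivative \<theta>' y) (at y)" "continuous_on UNIV \<theta>'"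
      "\<And>y. \<bar>\<theta> y\<bar> < L" "\<And>y. \<bar>\<theta>' y\<bar> \<le> 1" "\<And>y. \<bar>y\<bar> \<le> L' \<Longrightarrow> \<theta> y = y"
      by (rule soft_clamp[OF LL]) blast
    obtain f' where f': "continuous_on {-L<..<L} f'"
      "\<And>x. \<bar>x\<bar> < L \<Longrightarrow> (f has_real_derivative f' x) (at x)" "\<And>x. \<bar>x\<bar> < L \<Longrightarrow> deriv f x = f' x"
      by (rule Ck_on_Icc_derivE[OF h(10)[folded L_def]]) auto
    obtain g' where g': "continuous_on {-L<..<L} g'"
      "\<And>x. \<bar>x\<bar> < L \<Longrightarrow> (g has_real_derivative g' x) (at x)" "\<And>x. \<bar>x\<bar> < L \<Longrightarrow> deriv g x = g' x"
      by (rule Ck_on_Icc_derivE[OF h(11)[folded L_def]]) auto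
    \<comment> \<open>Iterates over \<open>x\<close> up to time \<open>Ts\<close> only see data on \<open>[-L', L']\<close>, where \<open>\<theta>\<close> is the identity.\<close>
    define F where "F \<sigma> y = (if \<sigma> = 1 then f (\<theta> y) else g (\<theta> y))" for \<sigma> y :: real
    define F' where "F' \<sigma> y = (if \<sigma> = 1 then f' (\<theta> y) * \<theta>' y else g' (\<theta> y) * \<theta>' y)" for \<sigma> y :: real
    define \<Gamma> where "\<Gamma> \<sigma> = (if \<sigma> = 1 then \<gamma>1 else \<gamma>2)" for \<sigma> :: real
    have \<Gamma>: "\<Gamma> 1 = \<gamma>1" "\<Gamma> (-1) = \<gamma>2" by (simp_all add: \<Gamma>_def)
    have \<theta>_cont: "continuous_on UNIV \<theta>"
      by (rule DERIV_continuous_on[OF \<theta>(1)[THEN has_field_derivative_at_within]])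
    interpret damped_wave p \<mu> \<epsilon>0 F F' \<Gamma>
    proof
      show "1 < p" "0 < \<mu>" "0 < \<epsilon>0" by fact+
      show "0 < \<Gamma> \<sigma>" for \<sigma> using h by (simp add: \<Gamma>_def)
      show "\<mu> * p * 2 powr p < (\<Gamma> 1 + \<Gamma> (-1)) powr (p - 1)"
      proof -
        have "((\<mu> * p * 2 powr p) powr (1 / (p - 1))) powr (p - 1) < (\<gamma>1 + \<gamma>2) powr (p - 1)"
          using h(7) assms(1) by (intro powr_less_mono2) auto
        then show ?thesis using assms(1) h(1) by (simp add: powr_powr \<Gamma>)
      qed
      show "\<Gamma> \<sigma> \<le> F \<sigma> y" for \<sigma> y
        using h(9) \<theta>(3)[of y] by (simp add: \<Gamma>_def F_def L_def)
      show "(F \<sigma> has_real_derivative F' \<sigma> y) (at y)" for \<sigma> y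
        using DERIV_chain2[OF f'(2)[OF \<theta>(3)] \<theta>(1)] DERIV_chain2[OF g'(2)[OF \<theta>(3)] \<theta>(1)]
        unfolding F_def F'_def by (cases "\<sigma> = 1") simp_all
      have range: "\<theta> ` UNIV \<subseteq> {-L<..<L}"
      proof (rule image_subsetI)
        show "\<theta> y \<in> {-L<..<L}" for y using \<theta>(3)[of y] by auto
      qed
      show "continuous_on UNIV (F' \<sigma>)" for \<sigma>
        unfolding F'_def using continuous_on_mult[OF continuous_on_compose2[OF f'(1) \<theta>_cont range] \<theta>(2)]
          continuous_on_mult[OF continuous_on_compose2[OF g'(1) \<theta>_cont range] \<theta>(2)]
        by (cases "\<sigma> = 1") simp_all
      show "(2 + \<epsilon>0) * \<bar>F' \<sigma> y\<bar>
          \<le> 2 powr (-p) * (\<Gamma> 1 + \<Gamma> (-1)) powr p - \<mu> / 2 * (\<Gamma> 1 + \<Gamma> (-1))" for \<sigma> y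
      proof -
        have "\<bar>c * \<theta>' y\<bar> \<le> \<bar>c\<bar>" for c
          using \<theta>(4)[of y] mult_left_mono[of "\<bar>\<theta>' y\<bar>" 1 "\<bar>c\<bar>"] by (simp add: abs_mult)
        from this[of "f' (\<theta> y)"] this[of "g' (\<theta> y)"]
        have "\<bar>F' \<sigma> y\<bar> \<le> \<bar>deriv f (\<theta> y)\<bar> + \<bar>deriv g (\<theta> y)\<bar>"
          using f'(3)[OF \<theta>(3)] g'(3)[OF \<theta>(3)]
          by (auto simp: F'_def intro: add_increasing add_increasing2)
        then have "(2 + \<epsilon>0) * \<bar>F' \<sigma> y\<bar> \<le> (2 + \<epsilon>0) * (\<bar>deriv f (\<theta> y)\<bar> + \<bar>deriv g (\<theta> y)\<bar>)"
          using assms(2) by (intro mult_left_mono) auto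
        also have "\<dots> \<le> 2 powr (-p) * (\<gamma>1 + \<gamma>2) powr p - \<mu> / 2 * (\<gamma>1 + \<gamma>2)"
          using h(12) \<theta>(3)[of y] by (simp add: L_def)
        finally show ?thesis by (simp add: \<Gamma>)
      qed
    qed
    have \<gamma>: "\<gamma> = \<gamma>1 + \<gamma>2" by (simp add: \<gamma>_def \<Gamma>)
    have W_eq: "W 1 n x s = phi_n p \<mu> f g \<gamma>1 \<gamma>2 n x s" "W (-1) n x s = psi_n p \<mu> f g \<gamma>1 \<gamma>2 n x s"
      if "0 < s" "s < Ts" for n s
    proof -
      have "f y = F 1 y" "g y = F (-1) y" if "\<bar>y\<bar> \<le> L'" for y
        using \<theta>(5)[OF that] by (simp_all add: F_def)
      from iter_cong[of L' f "F 1" g "F (-1)", OF this, of s x p \<mu> \<gamma>1 \<gamma>2 n] that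
      show "W 1 n x s = phi_n p \<mu> f g \<gamma>1 \<gamma>2 n x s" "W (-1) n x s = psi_n p \<mu> f g \<gamma>1 \<gamma>2 n x s"
        by (simp_all add: W_def \<Gamma> L'_def)
    qed
    define \<Phi> where "\<Phi> = phi_sup p \<mu> f g \<gamma>1 \<gamma>2 x"
    define \<Psi> where "\<Psi> = psi_sup p \<mu> f g \<gamma>1 \<gamma>2 x"
    define Tx where "Tx = blowup_time p \<mu> f g \<gamma>1 \<gamma>2 Ts x"
    define u where "u = real_of_ereal (\<Phi> t) + real_of_ereal (\<Psi> t)"
    have \<Phi>_eq: "\<Phi> s = (SUP n. ereal (W 1 n x s))" and \<Psi>_eq: "\<Psi> s = (SUP n. ereal (W (-1) n x s))"
      if "0 < s" "s < Ts" for s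
      using W_eq[OF that] by (simp_all add: \<Phi>_def \<Psi>_def phi_sup_def psi_sup_def)
    have Tx_eq: "Tx = Sup {s. 0 < s \<and> s < Ts \<and> \<Phi> s + \<Psi> s < \<infinity>}"
      by (simp add: Tx_def blowup_time_def \<Phi>_def \<Psi>_def)
    have "t < Tx" using xt(3) by (simp add: Tx_def)
    note est = blowup_estimates[of Ts \<Phi> x \<Psi> t, OF \<Phi>_eq \<Psi>_eq h(4) h(8)[folded \<gamma>] xt(2) \<open>t < Tx\<close>[unfolded Tx_eq],
        folded Tx_eq u_def]
    have u: "0 < u" and below: "d * u powr (1 - p) \<le> Tx - t" and above: "b * (Tx - t) \<le> u powr (1 - p)"
      using est(3-5) by (simp_all add: rate_below_def rate_above_def d_def b_def)
    have "0 < Tx - t" using \<open>t < Tx\<close> by simp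
    have inv: "(u powr (1 - p)) powr (-q) = u"
      using u q(1) by (simp add: powr_powr mult.commute del: mult_minus_left mult_minus_right)
    have u_le: "u \<le> b powr (-q) * (Tx - t) powr (-q)"
    proof -
      have "u = (u powr (1 - p)) powr (-q)" by (simp add: inv)
      also have "\<dots> \<le> (b * (Tx - t)) powr (-q)"
        using above pos \<open>0 < Tx - t\<close> by (intro powr_mono2') auto
      finally show ?thesis using pos \<open>0 < Tx - t\<close> by (simp add: powr_mult)
    qed
    have u_ge: "d powr q * (Tx - t) powr (-q) \<le> u"
    proof -
      have "(Tx - t) powr (-q) \<le> (d * u powr (1 - p)) powr (-q)"
        using below pos u by (intro powr_mono2') auto
      also have "\<dots> = d powr (-q) * u" using pos u by (simp add: powr_mult inv)
      finally have "d powr q * (Tx - t) powr (-q) \<le> d powr q * (d powr (-q) * u)"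
        by (intro mult_left_mono) auto
      also have "\<dots> = u" using pos by (simp add: powr_minus field_simps)
      finally show ?thesis .
    qed
    have up_le: "u powr p \<le> b powr (-q - 1) * (Tx - t) powr (-q - 1)"
    proof -
      have "u powr p \<le> (b powr (-q) * (Tx - t) powr (-q)) powr p"
        using u u_le assms by (intro powr_mono2) auto
      also have "\<dots> = b powr (-q * p) * (Tx - t) powr (-q * p)"
        using pos by (simp add: powr_mult powr_powr)
      finally show ?thesis by (simp only: q(2))
    qed
    have up_ge: "d powr (q + 1) * (Tx - t) powr (-q - 1) \<le> u powr p"
    proof -
      have "(d powr q * (Tx - t) powr (-q)) powr p \<le> u powr p"
        using u u_ge assms by (intro powr_mono2) auto
      moreover have "(d powr q * (Tx - t) powr (-q)) powr p = d powr (q * p) * (Tx - t) powr (-q * p)"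
        using pos by (simp add: powr_mult powr_powr)
      moreover have "q * p = q + 1" using q(3) by simp
      ultimately show ?thesis by (simp only: q(2))
    qed
    have C1: "C1 * v \<le> cl * v" "C1 * v \<le> cl * d powr (q + 1) * v" "C1 * v \<le> d powr q * v"
      and C2: "cu * v \<le> C2 * v" "cu * b powr (-q - 1) * v \<le> C2 * v" "b powr (-q) * v \<le> C2 * v"
      if "0 \<le> v" for v
      using that by (auto simp: C1_def C2_def intro!: mult_right_mono)
    have lower: "C1 * u powr p \<le> D" "C1 * (Tx - t) powr (-q - 1) \<le> D" if "cl * u powr p \<le> D" for D
    proof -
      show "C1 * u powr p \<le> D" using C1(1)[of "u powr p"] that by simp
      have "cl * (d powr (q + 1) * (Tx - t) powr (-q - 1)) \<le> cl * u powr p"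
        using up_ge pos by (intro mult_left_mono) auto
      then show "C1 * (Tx - t) powr (-q - 1) \<le> D"
        using C1(2)[of "(Tx - t) powr (-q - 1)"] that by (simp add: mult.assoc)
    qed
    have upper: "D \<le> C2 * u powr p" "D \<le> C2 * (Tx - t) powr (-q - 1)" if "D \<le> cu * u powr p" for D
    proof -
      show "D \<le> C2 * u powr p" using C2(1)[of "u powr p"] that by simp
      have "cu * u powr p \<le> cu * (b powr (-q - 1) * (Tx - t) powr (-q - 1))"
        using up_le pos by (intro mult_left_mono) auto
      then show "D \<le> C2 * (Tx - t) powr (-q - 1)"
        using C2(2)[of "(Tx - t) powr (-q - 1)"] that by (simp add: mult.assoc)
    qed
    obtain D1 where D1: "((\<lambda>s. real_of_ereal (\<Phi> s)) has_real_derivative D1) (at t)"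
      "cl * u powr p \<le> D1" "D1 \<le> cu * u powr p"
      using est(6) unfolding cl_def cu_def by blast
    obtain D2 where D2: "((\<lambda>s. real_of_ereal (\<Psi> s)) has_real_derivative D2) (at t)"
      "cl * u powr p \<le> D2" "D2 \<le> cu * u powr p"
      using est(7) unfolding cl_def cu_def by blast
    have S: "C1 * (Tx - t) powr (-q) \<le> u" "u \<le> C2 * (Tx - t) powr (-q)"
      using C1(3)[of "(Tx - t) powr (-q)"] C2(3)[of "(Tx - t) powr (-q)"] u_le u_ge by simp_all
    have \<Phi>\<Psi>: "phi p \<mu> f g \<gamma>1 \<gamma>2 x = (\<lambda>s. real_of_ereal (\<Phi> s))"
      "psi p \<mu> f g \<gamma>1 \<gamma>2 x = (\<lambda>s. real_of_ereal (\<Psi> s))"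
      by (simp_all add: fun_eq_iff phi_def psi_def \<Phi>_def \<Psi>_def)
    show "let \<Phi> = phi p \<mu> f g \<gamma>1 \<gamma>2; \<Psi> = psi p \<mu> f g \<gamma>1 \<gamma>2;
           S = \<Phi> x t + \<Psi> x t; Tx = blowup_time p \<mu> f g \<gamma>1 \<gamma>2 Ts x;
           q = 1 / (p - 1)
       in phi_sup p \<mu> f g \<gamma>1 \<gamma>2 x t < \<infinity> \<and> psi_sup p \<mu> f g \<gamma>1 \<gamma>2 x t < \<infinity> \<and>
          (\<exists>d\<Phi> d\<Psi>. ((\<lambda>s. \<Phi> x s) has_real_derivative d\<Phi>) (at t) \<and>
                    ((\<lambda>s. \<Psi> x s) has_real_derivative d\<Psi>) (at t) \<and>
             C1 * S powr p \<le> d\<Phi> \<and> d\<Phi> \<le> C2 * S powr p \<and>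
             C1 * (Tx - t) powr (-q - 1) \<le> d\<Phi> \<and> d\<Phi> \<le> C2 * (Tx - t) powr (-q - 1) \<and>
             C1 * S powr p \<le> d\<Psi> \<and> d\<Psi> \<le> C2 * S powr p \<and>
             C1 * (Tx - t) powr (-q - 1) \<le> d\<Psi> \<and> d\<Psi> \<le> C2 * (Tx - t) powr (-q - 1) \<and>
             C1 * (Tx - t) powr (-q) \<le> S \<and> S \<le> C2 * (Tx - t) powr (-q))"
      unfolding Let_def \<Phi>\<Psi> q_def[symmetric] Tx_def[symmetric] u_def[symmetric]
        fun_cong[OF \<Phi>_def, symmetric] fun_cong[OF \<Psi>_def, symmetric]
      using est(1,2) D1(1) D2(1) lower[OF D1(2)] lower[OF D2(2)] upper[OF D1(3)] upper[OF D2(3)] S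
      by blast
  qed
qed

end
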